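(* Let $N\ge 1$, $s\in(0,1)$, let $u_0\in C_0^\infty(\mathbb{R}^N)$ with $\operatorname{supp}(u_0)\subset B_L(0)$ for some $L>0$, and let $u=u(x,t)$ be the solution of the Cauchy problem for the fractional heat equation $$\partial_t u+(-\Delta)^s u=0 \ \text{ in } \mathbb{R}^N\times(0,\infty),\qquad u(x,0)=u_0(x)\ \text{ for } x\in\mathbb{R}^N.$$ Then the following conditions are equivalent: (1) $\nabla_x u(0,t)=0$ for any $t>0$; (2) $\displaystyle\int_{\mathbb{S}^{N-1}}\omega\,u_0(r\omega)\,d\omega=0$ for any $r\ge 0$.
   Context: $B_L(0)$ is the open ball of radius $L$ centered at the origin of $\mathbb{R}^N$; $\mathbb{S}^{N-1}$ is the unit sphere centered at the origin with surface measure $d\omega$ (counting measure on $\{\pm1\}$ if $N=1$); the integral in (2) is $\mathbb{R}^N$-valued. The fractional Laplacian is $(-\Delta)^s u(x)=c_{N,s}\lim_{\varepsilon\to0^+}\int_{|y-x|>\varepsilon}\frac{u(x)-u(y)}{|x-y|^{N+2s}}\,dy$ with $c_{N,s}=\frac{2^{2s}s\,\Gamma((N+2s)/2)}{\pi^{N/2}\Gamma(1-s)}$; equivalently, with the Fourier transform $\mathcal{F}f(\xi)=\int_{\mathbb{R}^N}f(x)e^{-2\pi i x\cdot\xi}dx$, it is the Fourier multiplier with symbol $(2\pi|\xi|)^{2s}$. The solution of the Cauchy problem is $u(x,t)=\int_{\mathbb{R}^N}P(x-y,t;s)u_0(y)\,dy$, where $P(\cdot,t;s)=\mathcal{F}^{-1}\big(e^{-t(2\pi|\xi|)^{2s}}\big)$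 is the fractional heat kernel. *)

theory Defs
  imports "HOL-Analysis.Analysis"
begin

section \<open>The space of smooth functions with compact support\<close>

text \<open>
  \<open>f\<close> is of class \<open>C\<^sup>k\<^sup>+\<^sup>1\<close> iff it is differentiable and all its partial derivatives (along the
  standard basis) are of class \<open>C\<^sup>k\<close>.
\<close>

primrec C_k :: "nat \<Rightarrow> ('a::euclidean_space \<Rightarrow> real) \<Rightarrow> bool" where
  "C_k 0 f \<longleftrightarrow> continuous_on UNIV f"
| "C_k (Suc k) f \<longleftrightarrow> (\<forall>x. f differentiable (at x)) \<and>
     (\<forall>b\<in>Basis. C_k k (\<lambda>x. frechet_derivative f (at x) b))"

definition supp :: "('a::topological_space \<Rightarrow> real) \<Rightarrow> 'a set" where
  "supp f = closure {x. f x \<noteq> 0}"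

definition C0_infinity :: "('a::euclidean_space \<Rightarrow> real) set" where
  "C0_infinity = {f. (\<forall>k. C_k k f) \<and> compact (supp f)}"


section \<open>Surface measure on the unit sphere\<close>

text \<open>
  The surface measure of a Borel subset \<open>A\<close> of the unit sphere in dimension \<open>N\<close> is \<open>N\<close> times the
  Lebesgue measure of the cone \<open>{r \<omega> | 0 < r < 1, \<omega> \<in> A}\<close>, which is the normalisation for which
  Lebesgue measure is \<open>r\<^sup>N\<^sup>-\<^sup>1 dr d\<omega>\<close> in polar coordinates.  It is realised as a push-forward
  under the radial projection \<open>sgn x = x /\<^sub>R norm x\<close>.
\<close>

definition sphere_measure :: "'a::euclidean_space measure" where
  "sphere_measure = scale_measure (of_nat DIM('a))
     (distr (restrict_space lborel (ball 0 1 - {0})) (restrict_space borel (sphere 0 1)) sgn)"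

lemma space_sphere_measure [simp]: "space sphere_measure = sphere 0 1"
  by (simp add: sphere_measure_def space_restrict_space space_scale_measure)

lemma sets_sphere_measure [measurable_cong]:
  "sets sphere_measure = sets (restrict_space borel (sphere 0 1))"
  by (simp add: sphere_measure_def)

lemma measurable_sgn_sphere:
  "sgn \<in> restrict_space lborel (ball 0 1 - {0 :: 'a::euclidean_space})
          \<rightarrow>\<^sub>M restrict_space borel (sphere 0 1)"
proof (rule measurable_restrict_space2)
  show "sgn \<in> space (restrict_space lborel (ball 0 1 - {0 :: 'a})) \<rightarrow> sphere 0 1"
    by (auto simp: space_restrict_space norm_sgn)
  show "sgn \<in> borel_measurable (restrict_space lborel (ball 0 1 - {0 :: 'a}))"
    by (rule measurable_restrict_space1) simp
qed

lemma emeasure_sphere_measure: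
  fixes A :: "'a::euclidean_space set"
  assumes "A \<in> sets borel" "A \<subseteq> sphere 0 1"
  shows "emeasure sphere_measure A =
           of_nat DIM('a) * emeasure lborel {r *\<^sub>R \<omega> | r \<omega>. 0 < r \<and> r < 1 \<and> \<omega> \<in> A}"
proof -
  have A: "A \<in> sets (restrict_space borel (sphere 0 1))"
    using assms by (auto simp: sets_restrict_space_iff)
  have eq: "sgn -` A \<inter> (ball 0 1 - {0}) = {r *\<^sub>R \<omega> | r \<omega>. 0 < r \<and> r < 1 \<and> \<omega> \<in> A}"
  proof (intro equalityI subsetI)
    fix x assume x: "x \<in> sgn -` A \<inter> (ball 0 1 - {0})"
    then have "x = norm x *\<^sub>R sgn x"
      by (simp add: sgn_div_norm)
    with x show "x \<in> {r *\<^sub>R \<omega> | r \<omega>. 0 < r \<and> r < 1 \<and> \<omega> \<in> A}"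
      by (intro CollectI exI[of _ "norm x"] exI[of _ "sgn x"]) simp
  next
    fix x assume "x \<in> {r *\<^sub>R \<omega> | r \<omega>. 0 < r \<and> r < 1 \<and> \<omega> \<in> A}"
    then obtain r \<omega> where x: "x = r *\<^sub>R \<omega>" "0 < r" "r < 1" "\<omega> \<in> A"
      by auto
    with assms have "norm \<omega> = 1"
      by auto
    with x show "x \<in> sgn -` A \<inter> (ball 0 1 - {0})"
      by (auto simp: sgn_div_norm)
  qed
  have "emeasure (distr (restrict_space lborel (ball 0 1 - {0})) (restrict_space borel (sphere 0 1)) sgn) A
        = emeasure lborel (sgn -` A \<inter> (ball 0 1 - {0}))"
    using A by (subst emeasure_distr[OF measurable_sgn_sphere])
      (auto simp: space_restrict_space emeasure_restrict_space)
  then show ?thesis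
    by (simp add: sphere_measure_def eq)
qed

lemma sphere_measure_total:
  "emeasure sphere_measure (sphere 0 1 :: 'a::euclidean_space set) =
     ennreal (DIM('a) * unit_ball_vol DIM('a))"
proof -
  have eq: "{r *\<^sub>R \<omega> | r \<omega>. 0 < r \<and> r < 1 \<and> \<omega> \<in> sphere 0 1} = ball 0 1 - {0 :: 'a}"
  proof (intro equalityI subsetI)
    fix x :: 'a assume x: "x \<in> ball 0 1 - {0}"
    then have "x = norm x *\<^sub>R sgn x" "norm (sgn x) = 1"
      by (simp_all add: sgn_div_norm)
    with x show "x \<in> {r *\<^sub>R \<omega> | r \<omega>. 0 < r \<and> r < 1 \<and> \<omega> \<in> sphere 0 1}"
      by (intro CollectI exI[of _ "norm x"] exI[of _ "sgn x"]) simp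
  qed auto
  have "emeasure lborel (ball 0 1 - {0 :: 'a}) = emeasure lborel (ball 0 1 :: 'a set)"
    by (simp add: emeasure_Diff)
  moreover have "emeasure sphere_measure (sphere 0 1 :: 'a set) =
      of_nat DIM('a) * emeasure lborel (ball 0 1 - {0 :: 'a})"
    unfolding eq[symmetric] by (rule emeasure_sphere_measure) auto
  ultimately show ?thesis
    by (simp add: emeasure_ball ennreal_mult' ennreal_of_nat_eq_real_of_nat)
qed

text \<open>In dimension one the surface measure is the counting measure on \<open>{-1, 1}\<close>.\<close>

lemma sphere_measure_real: "sphere_measure = count_space {-1, 1 :: real}"
proof (rule measure_eqI)
  have sphere: "sphere 0 1 = {-1, 1 :: real}"
    by auto
  have "A \<in> sets borel" if "A \<subseteq> {-1, 1 :: real}" for A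
    using that finite_subset[OF that] by (auto intro: borel_closed finite_imp_closed)
  then have "sets (restrict_space borel {-1, 1 :: real}) = Pow {-1, 1}"
    by (subst set_eq_iff, subst sets_restrict_space_iff) auto
  then show "sets sphere_measure = sets (count_space {-1, 1 :: real})"
    by (simp add: sets_sphere_measure sphere)
  fix A :: "real set"
  assume "A \<in> sets sphere_measure"
  then have A: "A \<in> sets borel" "A \<subseteq> sphere 0 1"
    by (auto simp: sets_sphere_measure sets_restrict_space_iff)
  have "{r *\<^sub>R \<omega> | r \<omega>. 0 < r \<and> r < 1 \<and> \<omega> \<in> {1 :: real}} = {0<..<1}"
    by auto
  then have 1: "emeasure sphere_measure {1 :: real} = 1"
    by (subst emeasure_sphere_measure) auto
  have "{r *\<^sub>R \<omega> | r \<omega>. 0 < r \<and> r < 1 \<and> \<omega> \<in> {-1 :: real}} = {-1<..<0}"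
    by (auto intro!: exI[of _ "- x" for x])
  then have 2: "emeasure sphere_measure {-1 :: real} = 1"
    by (subst emeasure_sphere_measure) auto
  have "A \<in> Pow {-1, 1}"
    using A sphere by auto
  then have "A = {} \<or> A = {-1} \<or> A = {1} \<or> A = {-1, 1}"
    by (auto simp: Pow_insert)
  moreover have "emeasure sphere_measure {-1, 1 :: real} = 2"
    using sphere_measure_total[where ?'a = real] unit_ball_vol_1 by (simp add: sphere)
  ultimately show "emeasure sphere_measure A = emeasure (count_space {-1, 1}) A"
    using 1 2 by (elim disjE) simp_all
qed


section \<open>The solution of the fractional heat equation\<close>

definition inverse_fourier :: "('a::euclidean_space \<Rightarrow> complex) \<Rightarrow> 'a \<Rightarrow> complex" where
  "inverse_fourier f x = (\<integral>\<xi>. f \<xi> * exp (2 * of_real pi * \<i> * of_real (x \<bullet> \<xi>)) \<partial>lborel)"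

text \<open>
  The kernel is real-valued (see \<open>frac_heat_kernel_eq\<close> below), so that taking the real
  part loses nothing.
\<close>

definition frac_heat_kernel :: "real \<Rightarrow> real \<Rightarrow> 'a::euclidean_space \<Rightarrow> real" where
  "frac_heat_kernel s t x =
     Re (inverse_fourier (\<lambda>\<xi>. of_real (exp (- t * (2 * pi * norm \<xi>) powr (2 * s)))) x)"

lemma frac_heat_kernel_eq:
  fixes x :: "'a::euclidean_space"
  shows "complex_of_real (frac_heat_kernel s t x) =
     inverse_fourier (\<lambda>\<xi>. of_real (exp (- t * (2 * pi * norm \<xi>) powr (2 * s)))) x"
proof -
  define f :: "'a \<Rightarrow> complex" where
    "f = (\<lambda>\<xi>. of_real (exp (- t * (2 * pi * norm \<xi>) powr (2 * s))) *
                exp (2 * of_real pi * \<i> * of_real (x \<bullet> \<xi>)))"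
  have "distr lborel borel (\<lambda>\<xi>. - \<xi>) = (lborel :: 'a measure)"
    using lborel_affine[of "-1" "0 :: 'a"] by (simp add: density_1)
  then have "integral\<^sup>L lborel f = integral\<^sup>L (distr lborel borel (\<lambda>\<xi>. - \<xi>)) f"
    by simp
  also have "\<dots> = (\<integral>\<xi>. f (- \<xi>) \<partial>lborel)"
    by (rule integral_distr) (auto simp: f_def)
  also have "\<dots> = (\<integral>\<xi>. cnj (f \<xi>) \<partial>lborel)"
    by (simp add: f_def exp_cnj)
  also have "\<dots> = cnj (integral\<^sup>L lborel f)"
    by simp
  finally have "Im (integral\<^sup>L lborel f) = 0"
    by (simp add: complex_eq_iff)
  then show ?thesis
    by (simp add: complex_eq_iff frac_heat_kernel_def inverse_fourier_def f_def)
qed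

definition frac_heat_solution :: "real \<Rightarrow> ('a::euclidean_space \<Rightarrow> real) \<Rightarrow> 'a \<Rightarrow> real \<Rightarrow> real" where
  "frac_heat_solution s u0 x t =
     (if t = 0 then u0 x else (\<integral>y. frac_heat_kernel s t (x - y) * u0 y \<partial>lborel))"

end

theory Submission
  imports Defs "HOL-Probability.Probability"
begin

text \<open>
  On the Fourier side \<open>\<nabla>u(0,t) = \<integral> exp (- t |2 \<pi> \<xi>|\<^sup>2\<^sup>s) F(\<xi>) d\<xi>\<close> with
  \<open>F(\<xi>) = 2 \<pi> \<xi> \<integral> u0(y) sin (2 \<pi> y \<bullet> \<xi>) dy\<close>.  By the Weierstrass theorem in the variable
  \<open>exp (- a |\<xi>|\<^sup>p)\<close>, the integrals of \<open>F\<close> against \<open>exp (- a |\<xi>|\<^sup>p)\<close> vanish for all \<open>a > 0\<close> as soon as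
  they do so for one other exponent, so the weights may be taken to be Gaussians.  For these the
  Fourier transform is explicit and the condition becomes
  \<open>\<integral> exp (- a |y|\<^sup>2) u0(y) y dy = 0\<close> for all \<open>a > 0\<close>.  In polar coordinates this concerns only the
  spherical means \<open>\<integral> u0(r \<omega>) \<omega> d\<omega>\<close>, and by the Weierstrass theorem again it
  forces them to vanish.
\<close>

section \<open>Radial exponential weights determine each other\<close>

text \<open>Why change the exponent: for general \<open>s\<close> the heat kernel has no elementary
  formula, whereas exponent 2 makes every constant explicit. The change is possible because the
  weights \<open>exp (- (k * a) * q powr p)\<close> are powers of one function with values in (0,
  1], and all powers are available since time ranges over all positive numbers. The constant power
  is missing, however, because \<open>F\<close> enters only through weighted integrability. So one
  factor is kept aside as an integrable weight and the polynomial approximation takes place in the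
  others. A second obstacle is that the quotient of weights with different exponents may be
  unbounded, so the change of exponent passes through a product of both weights. Only sines survive
  in \<open>F\<close> because the multiplier is even: the gradient at the origin sees just the odd
  part of \<open>u0\<close>. The same approximation lemma serves twice, on the frequency side for
  \<open>F\<close> and in physical space for \<open>u0 y *\<^sub>R y\<close>, and is therefore
  stated for an abstract vector-valued integrand.\<close>

lemma filterlim_powr_at_top:
  fixes p :: real
  assumes "p > 0"
  shows "filterlim (\<lambda>x. x powr p) at_top at_top"
proof -
  have "filterlim (\<lambda>x. exp (p * ln x)) at_top at_top"
    using assms by (intro filterlim_compose[OF exp_at_top]
        filterlim_tendsto_pos_mult_at_top[OF tendsto_const _ ln_at_top]) auto
  moreover have "\<forall>\<^sub>F x in at_top. exp (p * ln x) = x powr p"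
    using eventually_gt_at_top[of 0] by eventually_elim (simp add: powr_def)
  ultimately show ?thesis
    by (rule filterlim_cong[THEN iffD1, OF refl refl, rotated])
qed

text \<open>The substitution \<open>z = exp (- a * r powr p)\<close> compactifies the half-line: r =
  0 becomes z = 1 and r at infinity becomes z = 0. A limit of \<open>h\<close> at infinity is
  exactly what makes the transformed function continuous at z = 0, hence accessible to polynomial
  approximation on a compact interval.\<close>

lemma continuous_on_compose_neg_ln:
  fixes h :: "real \<Rightarrow> real"
  assumes "a > 0" "p > 0" and h: "continuous_on {0..} h" "(h \<longlongrightarrow> l) at_top"
  shows "continuous_on {0..1} (\<lambda>z. if z = 0 then l else h ((- ln z / a) powr (1 / p)))"
    (is "continuous_on _ ?G")
proof -
  have cont: "continuous_on {0<..1} (\<lambda>z. h ((- ln z / a) powr (1 / p)))"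
  proof (rule continuous_on_compose2[OF h(1)])
    show "continuous_on {0<..1} (\<lambda>z. (- ln z / a) powr (1 / p))"
      using assms by (intro continuous_on_powr' continuous_on_divide continuous_on_minus continuous_on_ln continuous_on_id continuous_on_const) (auto simp: divide_le_0_iff)
  qed auto
  have "filterlim (\<lambda>z. - ln z / a) at_top (at_right 0)"
    using filterlim_tendsto_pos_mult_at_bot[OF tendsto_const _ ln_at_0, of "1 / a"] \<open>a > 0\<close>
    by (simp add: filterlim_uminus_at_top)
  moreover have "filterlim (\<lambda>x::real. x powr (1 / p)) at_top at_top"
    using \<open>p > 0\<close> by (intro filterlim_powr_at_top) auto
  ultimately have "filterlim (\<lambda>z. (- ln z / a) powr (1 / p)) at_top (at_right 0)"
    by (rule filterlim_compose[rotated])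
  then have "((\<lambda>z. h ((- ln z / a) powr (1 / p))) \<longlongrightarrow> l) (at_right 0)"
    by (rule filterlim_compose[OF h(2)])
  then have lim: "((\<lambda>z. h ((- ln z / a) powr (1 / p))) \<longlongrightarrow> l) (at 0 within {0..1})"
    by (rule filterlim_mono) (auto simp: at_le at_within_def intro!: le_infI2)
  show ?thesis
    unfolding continuous_on_def
  proof
    fix z :: real assume z: "z \<in> {0..1}"
    show "(?G \<longlongrightarrow> ?G z) (at z within {0..1})"
    proof (cases "z = 0")
      case True
      have "(?G \<longlongrightarrow> l) (at 0 within {0..1})"
        by (rule Lim_transform_eventually[OF lim])
           (auto simp: eventually_at_filter)
      with True show ?thesis by simp
    next
      case False
      with z have "((\<lambda>z. h ((- ln z / a) powr (1 / p))) \<longlongrightarrow> ?G z) (at z within {0<..1})"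
        using cont by (auto simp: continuous_on_def)
      also have "at z within {0<..1} = at z within {0..1}"
        using False z by (intro at_within_nhd[of _ "{0<..}"]) auto
      finally show ?thesis
        by (rule Lim_transform_within_open[of _ _ _ _ "{0<..}"]) (use z False in auto)
    qed
  qed
qed

text \<open>With \<open>w = exp (- a * q powr p)\<close>, the hypothesis \<open>zero\<close> says
  that the integrable function \<open>w *\<^sub>R F\<close> is orthogonal to every power of
  \<open>w\<close>, hence to every polynomial in \<open>w\<close>. Since \<open>h (q x)\<close> is a
  continuous function of \<open>w x\<close> on [0, 1], a uniform error \<open>e\<close> of
  approximation costs at most \<open>e\<close> times the L1 norm of \<open>w *\<^sub>R F\<close>.
  The shift \<open>Suc k\<close> is the one factor spent on integrability.\<close>

lemma integral_weight_eq_0: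
  fixes F :: "'a \<Rightarrow> 'b::{banach, second_countable_topology}" and q :: "'a \<Rightarrow> real"
  assumes q[measurable]: "q \<in> borel_measurable M" and q_nonneg: "\<And>x. 0 \<le> q x"
    and "a > 0" "p > 0"
    and int: "integrable M (\<lambda>x. exp (- a * q x powr p) *\<^sub>R F x)"
    and zero: "\<And>k::nat. (\<integral>x. exp (- (real (Suc k) * a) * q x powr p) *\<^sub>R F x \<partial>M) = 0"
    and h: "continuous_on {0..} h" "(h \<longlongrightarrow> l) at_top"
  shows "(\<integral>x. (exp (- a * q x powr p) * h (q x)) *\<^sub>R F x \<partial>M) = 0"
proof -
  define w where "w x = exp (- a * q x powr p)" for x
  define W where "W x = w x *\<^sub>R F x" for x
  define G where "G = (\<lambda>z. if z = 0 then l else h ((- ln z / a) powr (1 / p)))"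
  have w: "0 < w x" "w x \<le> 1" for x
    using \<open>a > 0\<close> by (auto simp: w_def)
  have [measurable]: "w \<in> borel_measurable M"
    unfolding w_def by measurable
  have W: "integrable M W"
    using int by (simp add: W_def[abs_def] w_def)
  have Gw: "G (w x) = h (q x)" for x
    using w[of x] q_nonneg[of x] \<open>a > 0\<close> \<open>p > 0\<close>
    by (simp add: G_def w_def powr_powr)
  have contG: "continuous_on {0..1} G"
    unfolding G_def using assms by (intro continuous_on_compose_neg_ln)
  have pow: "integrable M (\<lambda>x. w x ^ k *\<^sub>R W x)" for k
    by (rule Bochner_Integration.integrable_bound[OF W])
       (use W w in \<open>auto simp: power_le_one less_imp_le abs_of_pos intro!: AE_I2 mult_left_le_one_le\<close>)
  have pow0: "(\<integral>x. w x ^ k *\<^sub>R W x \<partial>M) = 0" for k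
  proof -
    have "w x ^ k *\<^sub>R W x = exp (- (real (Suc k) * a) * q x powr p) *\<^sub>R F x" for x
      by (simp add: W_def w_def flip: exp_of_nat_mult exp_add) (simp add: algebra_simps)
    then show ?thesis using zero[of k] by simp
  qed
  define C where "C = (\<integral>x. norm (W x) \<partial>M)"
  have GW: "(\<lambda>x. G (w x) *\<^sub>R W x) \<in> borel_measurable M"
  proof -
    \<comment> \<open>\<open>G\<close> is continuous on [0, 1] only; clamping the argument extends
      it continuously to the line, and nothing changes on the range of \<open>w\<close>.\<close>
    have "(\<lambda>z. G (max 0 (min 1 z))) \<in> borel_measurable borel"
      by (intro borel_measurable_continuous_onI continuous_on_compose2[OF contG] continuous_intros) auto
    then have "(\<lambda>x. G (max 0 (min 1 (w x)))) \<in> borel_measurable M"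
      by measurable
    also have "(\<lambda>x. G (max 0 (min 1 (w x)))) = (\<lambda>x. G (w x))"
      using w by (simp add: min_absorb2 max_absorb2 less_imp_le)
    finally show ?thesis
      using W by auto
  qed
  have "norm (\<integral>x. G (w x) *\<^sub>R W x \<partial>M) \<le> e * C" if "e > 0" for e
  proof -
    obtain g where g: "real_polynomial_function g" "\<And>x. x \<in> {0..1} \<Longrightarrow> \<bar>G x - g x\<bar> < e"
      using Stone_Weierstrass_real_polynomial_function[OF compact_Icc contG \<open>e > 0\<close>] by blast
    from g(1) obtain c n where gc: "g = (\<lambda>x. \<Sum>i\<le>n. c i * x ^ i)"
      unfolding real_polynomial_function_iff_sum by blast
    have gW: "g (w x) *\<^sub>R W x = (\<Sum>i\<le>n. c i *\<^sub>R (w x ^ i *\<^sub>R W x))" for x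
      by (simp add: gc scaleR_sum_left)
    have intg: "integrable M (\<lambda>x. g (w x) *\<^sub>R W x)"
      unfolding gW by (intro Bochner_Integration.integrable_sum integrable_scaleR_right pow)
    have g0: "(\<integral>x. g (w x) *\<^sub>R W x \<partial>M) = 0"
      unfolding gW using pow pow0
      by (subst Bochner_Integration.integral_sum) (auto simp del: scaleR_scaleR)
    have le: "norm (G (w x) *\<^sub>R W x - g (w x) *\<^sub>R W x) \<le> e * norm (W x)" for x
      using g(2)[of "w x"] w[of x]
      by (auto simp flip: scaleR_diff_left intro!: mult_right_mono)
    have intd: "integrable M (\<lambda>x. G (w x) *\<^sub>R W x - g (w x) *\<^sub>R W x)"
      by (rule Bochner_Integration.integrable_bound[where f="\<lambda>x. e * norm (W x)"])
         (use le W GW intg that in \<open>auto intro!: AE_I2 simp: abs_mult\<close>)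
    have "integrable M (\<lambda>x. G (w x) *\<^sub>R W x)"
      using Bochner_Integration.integrable_add[OF intd intg] by simp
    then have "(\<integral>x. G (w x) *\<^sub>R W x \<partial>M) = (\<integral>x. G (w x) *\<^sub>R W x - g (w x) *\<^sub>R W x \<partial>M)"
      using intg g0 by simp
    also have "norm \<dots> \<le> (\<integral>x. e * norm (W x) \<partial>M)"
      using le intd W
      by (intro order_trans[OF integral_norm_bound] integral_mono) auto
    finally show ?thesis by (simp add: C_def)
  qed
  then have "norm (\<integral>x. G (w x) *\<^sub>R W x \<partial>M) \<le> 0 * C"
    by (intro tendsto_lowerbound[of "\<lambda>e. e * C" _ "at_right 0"])
       (auto intro!: tendsto_eq_intros simp: eventually_at_filter)
  then have "(\<integral>x. G (w x) *\<^sub>R W x \<partial>M) = 0" by simp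
  moreover have "G (w x) *\<^sub>R W x = (exp (- a * q x powr p) * h (q x)) *\<^sub>R F x" for x
    unfolding Gw by (simp add: W_def w_def mult.commute)
  ultimately show ?thesis by simp
qed

text \<open>Writing the new weight as the old one times some \<open>h\<close> would give an
  unbounded \<open>h\<close> when p' < p. Instead \<open>h r = exp (- a' * r powr p')\<close>, which
  tends to 0, yields the claim with an extra factor
  \<open>exp (- \<epsilon> n * q x powr p)\<close>. This factor is removed by dominated convergence
  as \<open>\<epsilon> n\<close> tends to 0.\<close>

lemma integral_exp_powr_transfer:
  fixes F :: "'a \<Rightarrow> 'b::{banach, second_countable_topology}" and q :: "'a \<Rightarrow> real"
  assumes q[measurable]: "q \<in> borel_measurable M" and q_nonneg: "\<And>x. 0 \<le> q x"
    and "p > 0" "p' > 0" "a' > 0"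
    and int: "\<And>a. a > 0 \<Longrightarrow> integrable M (\<lambda>x. exp (- a * q x powr p) *\<^sub>R F x)"
    and zero: "\<And>a. a > 0 \<Longrightarrow> (\<integral>x. exp (- a * q x powr p) *\<^sub>R F x \<partial>M) = 0"
    and int': "integrable M (\<lambda>x. exp (- a' * q x powr p') *\<^sub>R F x)"
  shows "(\<integral>x. exp (- a' * q x powr p') *\<^sub>R F x \<partial>M) = 0"
proof -
  define W where "W x = exp (- a' * q x powr p') *\<^sub>R F x" for x
  define \<epsilon> where "\<epsilon> n = inverse (real (Suc n))" for n
  have \<epsilon>: "\<epsilon> n > 0" for n by (simp add: \<epsilon>_def)
  have W: "integrable M W" using int' by (simp add: W_def[abs_def])
  have zero_n: "(\<integral>x. exp (- \<epsilon> n * q x powr p) *\<^sub>R W x \<partial>M) = 0" for n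
  proof -
    have "filterlim (\<lambda>r. r powr p') at_top at_top"
      using \<open>p' > 0\<close> by (rule filterlim_powr_at_top)
    then have "filterlim (\<lambda>r. - a' * r powr p') at_bot at_top"
      using \<open>a' > 0\<close> filterlim_tendsto_pos_mult_at_top[OF tendsto_const, of a' "\<lambda>r. r powr p'"]
      by (simp add: filterlim_uminus_at_bot)
    then have lim: "((\<lambda>r. exp (- a' * r powr p')) \<longlongrightarrow> 0) at_top"
      by (rule filterlim_compose[OF exp_at_bot])
    have cont: "continuous_on {0..} (\<lambda>r::real. exp (- a' * r powr p'))"
      using \<open>p' > 0\<close> by (intro continuous_intros continuous_on_powr') auto
    have "(\<integral>x. (exp (- \<epsilon> n * q x powr p) * exp (- a' * q x powr p')) *\<^sub>R F x \<partial>M) = 0"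
      using \<epsilon>[of n] \<open>p > 0\<close> q_nonneg
      by (intro integral_weight_eq_0[OF q _ _ _ _ _ cont lim] int zero) auto
    then show ?thesis by (simp add: W_def)
  qed
  have "(\<lambda>n. \<integral>x. exp (- \<epsilon> n * q x powr p) *\<^sub>R W x \<partial>M) \<longlonglongrightarrow> (\<integral>x. W x \<partial>M)"
  proof (rule integral_dominated_convergence[where w="\<lambda>x. norm (W x)"])
    show "AE x in M. (\<lambda>n. exp (- \<epsilon> n * q x powr p) *\<^sub>R W x) \<longlonglongrightarrow> W x"
    proof (rule AE_I2)
      fix x
      have "(\<lambda>n. exp (- \<epsilon> n * q x powr p) *\<^sub>R W x) \<longlonglongrightarrow> exp (- 0 * q x powr p) *\<^sub>R W x"
        unfolding \<epsilon>_def by (intro tendsto_intros LIMSEQ_inverse_real_of_nat)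
      then show "(\<lambda>n. exp (- \<epsilon> n * q x powr p) *\<^sub>R W x) \<longlonglongrightarrow> W x" by simp
    qed
    show "AE x in M. norm (exp (- \<epsilon> n * q x powr p) *\<^sub>R W x) \<le> norm (W x)" for n
      using \<epsilon>[of n] by (intro AE_I2) (auto intro!: mult_left_le_one_le)
  qed (use W in auto)
  then have "(\<integral>x. W x \<partial>M) = 0"
    unfolding zero_n by (simp add: LIMSEQ_const_iff)
  then show ?thesis by (simp add: W_def)
qed

section \<open>Polar coordinates\<close>

lemma nn_integral_lborel_scaleR:
  fixes f :: "'a::euclidean_space \<Rightarrow> ennreal"
  assumes [measurable]: "f \<in> borel_measurable borel" and "c > 0"
  shows "(\<integral>\<^sup>+x. f x \<partial>lborel) = ennreal (c ^ DIM('a)) * (\<integral>\<^sup>+x. f (c *\<^sub>R x) \<partial>lborel)"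
  using assms(2)
  by (subst lborel_affine[of c 0])
     (simp_all add: nn_integral_density nn_integral_distr nn_integral_cmult)

text \<open>This is the inner integral left at the end of \<open>nn_integral_polar\<close>; its
  factor 1/N cancels the normalising factor N of \<open>sphere_measure\<close>.\<close>

lemma nn_integral_power_tail:
  fixes c :: real
  assumes "c > 0" "N > 0"
  shows "(\<integral>\<^sup>+r. ennreal (1 / r ^ Suc N) * indicator {c<..} r \<partial>lborel) = ennreal (1 / (real N * c ^ N))"
proof -
  have "(\<integral>\<^sup>+r. ennreal (1 / r ^ Suc N) * indicator {c<..} r \<partial>lborel)
      = (\<integral>\<^sup>+r. ennreal (1 / r ^ Suc N) * indicator {c..} r \<partial>lborel)"
    by (rule nn_integral_cong_AE, rule eventually_mono[OF AE_lborel_singleton[of c]])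
       (auto simp: indicator_def)
  also have "\<dots> = ennreal (0 - - (1 / (real N * c ^ N)))"
  proof (rule nn_integral_FTC_atLeast)
    fix r assume r: "c \<le> r"
    with \<open>c > 0\<close> show "0 \<le> 1 / r ^ Suc N" by simp
    have "((\<lambda>r. - inverse (real N) * inverse (r ^ N)) has_real_derivative
        - inverse (real N) * - (inverse (r ^ N) * (real N * r ^ (N - 1)) * inverse (r ^ N))) (at r)"
      using r \<open>c > 0\<close> by (intro DERIV_cmult DERIV_inverse') (auto intro: DERIV_pow)
    also have "- inverse (real N) * - (inverse (r ^ N) * (real N * r ^ (N - 1)) * inverse (r ^ N)) = 1 / r ^ Suc N"
      using r assms by (cases N) (simp_all add: divide_inverse del: of_nat_Suc)
    also have "(\<lambda>r. - inverse (real N) * inverse (r ^ N)) = (\<lambda>r. - (1 / (real N * r ^ N)))"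
      by (simp add: divide_inverse)
    finally show "((\<lambda>r. - (1 / (real N * r ^ N))) has_real_derivative 1 / r ^ Suc N) (at r)" .
  next
    have "((\<lambda>r. - (1 / real N) * (1 / r ^ N)) \<longlongrightarrow> - (1 / real N) * 0) at_top"
      using \<open>N > 0\<close> by (intro tendsto_mult tendsto_const real_tendsto_divide_at_top[OF tendsto_const]
          filterlim_pow_at_top filterlim_ident) auto
    then show "((\<lambda>r. - (1 / (real N * r ^ N))) \<longlongrightarrow> 0) at_top" by simp
  qed measurable
  finally show ?thesis unfolding diff_minus_eq_add add_0 .
qed

lemma nn_integral_sphere_measure:
  fixes g :: "'a::euclidean_space \<Rightarrow> ennreal"
  assumes [measurable]: "g \<in> borel_measurable borel"
  shows "(\<integral>\<^sup>+\<omega>. g \<omega> \<partial>sphere_measure) =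
    of_nat DIM('a) * (\<integral>\<^sup>+x. g (sgn x) * indicator (ball 0 1 - {0}) x \<partial>lborel)"
proof -
  have g: "g \<in> borel_measurable (restrict_space borel (sphere 0 1))"
    by (intro measurable_restrict_space1 assms)
  then show ?thesis
    unfolding sphere_measure_def
    by (subst nn_integral_scale_measure)
       (simp_all add: nn_integral_distr[OF measurable_sgn_sphere] nn_integral_restrict_space)
qed

text \<open>
  Insert the definition of \<^const>\<open>sphere_measure\<close>, substitute \<open>r = norm x * \<rho>\<close> and then
  \<open>y = \<rho> *\<^sub>R x\<close>; what remains of the \<open>\<rho>\<close>-integral is that of \<open>1 / \<rho> ^ Suc N\<close> over \<open>\<rho> > norm y\<close>.
\<close>

lemma nn_integral_polar:
  fixes f :: "'a::euclidean_space \<Rightarrow> ennreal"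
  assumes f[measurable]: "f \<in> borel_measurable borel"
  shows "(\<integral>\<^sup>+x. f x \<partial>lborel) =
    (\<integral>\<^sup>+r. (ennreal (r ^ (DIM('a) - 1)) * indicator {0<..} r) *
      (\<integral>\<^sup>+\<omega>. f (r *\<^sub>R \<omega>) \<partial>sphere_measure) \<partial>lborel)"
proof -
  let ?N = "DIM('a)"
  let ?B = "indicator (ball 0 1 - {0::'a})"
  let ?P = "\<lambda>r::real. indicator {0<..} r :: ennreal"
  have [measurable]: "(?B :: 'a \<Rightarrow> ennreal) \<in> borel_measurable borel"
    by (intro borel_measurable_indicator) auto
  have [measurable]: "(indicator (-{0}) :: 'a \<Rightarrow> ennreal) \<in> borel_measurable borel"
    by (intro borel_measurable_indicator) auto
  have [measurable]: "Measurable.pred (borel \<Otimes>\<^sub>M borel) (\<lambda>x. snd x \<in> {norm (fst x :: 'a)<..})"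
    unfolding greaterThan_iff by measurable
  \<comment> \<open>One factor \<open>norm x\<close> is the Jacobian, the other N - 1 come from the
    weight; at x = 0 both sides vanish because the punctured ball omits the origin.\<close>
  have subst_r: "(\<integral>\<^sup>+r. (ennreal (r ^ (?N - 1)) * ?P r) * (f (r *\<^sub>R sgn x) * ?B x) \<partial>lborel) =
      (\<integral>\<^sup>+\<rho>. ennreal (norm x ^ ?N * \<rho> ^ (?N - 1)) * ?P \<rho> * (f (\<rho> *\<^sub>R x) * ?B x) \<partial>lborel)" for x
  proof (cases "x = 0")
    case False
    then have x: "norm x > 0" by simp
    have "(\<integral>\<^sup>+r. (ennreal (r ^ (?N - 1)) * ?P r) * (f (r *\<^sub>R sgn x) * ?B x) \<partial>lborel) =
        ennreal \<bar>norm x\<bar> * (\<integral>\<^sup>+\<rho>. (ennreal ((0 + norm x * \<rho>) ^ (?N - 1)) * ?P (0 + norm x * \<rho>)) *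
          (f ((0 + norm x * \<rho>) *\<^sub>R sgn x) * ?B x) \<partial>lborel)"
      using x by (intro nn_integral_real_affine) auto
    also have "\<dots> = (\<integral>\<^sup>+\<rho>. ennreal (norm x) * ((ennreal ((norm x * \<rho>) ^ (?N - 1)) * ?P (norm x * \<rho>)) *
          (f ((norm x * \<rho>) *\<^sub>R sgn x) * ?B x)) \<partial>lborel)"
      by (subst nn_integral_cmult) auto
    also have "\<dots> = (\<integral>\<^sup>+\<rho>. ennreal (norm x ^ ?N * \<rho> ^ (?N - 1)) * ?P \<rho> * (f (\<rho> *\<^sub>R x) * ?B x) \<partial>lborel)"
    proof (intro nn_integral_cong)
      fix \<rho> :: real
      show "ennreal (norm x) * ((ennreal ((norm x * \<rho>) ^ (?N - 1)) * ?P (norm x * \<rho>)) *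
          (f ((norm x * \<rho>) *\<^sub>R sgn x) * ?B x)) =
          ennreal (norm x ^ ?N * \<rho> ^ (?N - 1)) * ?P \<rho> * (f (\<rho> *\<^sub>R x) * ?B x)"
      proof (cases "\<rho> > 0")
        case True
        have "norm x * (norm x * \<rho>) ^ (?N - 1) = norm x ^ ?N * \<rho> ^ (?N - 1)"
          using DIM_positive[where 'a='a] by (cases "DIM('a)") (auto simp: power_mult_distrib)
        then have "ennreal (norm x) * ennreal ((norm x * \<rho>) ^ (?N - 1)) = ennreal (norm x ^ ?N * \<rho> ^ (?N - 1))"
          using x True by (simp flip: ennreal_mult)
        moreover have "(norm x * \<rho>) *\<^sub>R sgn x = \<rho> *\<^sub>R x"
          using x by (simp add: sgn_div_norm)
        ultimately show ?thesis
          using x True by (simp add: mult.assoc[symmetric])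
      qed (use x in \<open>auto simp: zero_less_mult_iff\<close>)
    qed
    finally show ?thesis .
  qed simp
  \<comment> \<open>With y = rho x the condition |x| < 1 becomes |y| < rho. The Jacobian rho^N and
    |y|^N = rho^N |x|^N combine with rho^(-N-1) to |x|^N rho^(N-1). For rho <= 0 both sides are
    0.\<close>
  have subst_x: "(\<integral>\<^sup>+x. ennreal (norm x ^ ?N * \<rho> ^ (?N - 1)) * ?P \<rho> * (f (\<rho> *\<^sub>R x) * ?B x) \<partial>lborel) =
      (\<integral>\<^sup>+y. ennreal (norm y ^ ?N) * f y * (ennreal (1 / \<rho> ^ Suc ?N) * indicator {norm y<..} \<rho>) * indicator (-{0}) y \<partial>lborel)"
    for \<rho>
  proof (cases "\<rho> > 0")
    case True
    have "(\<integral>\<^sup>+y. ennreal (norm y ^ ?N) * f y * (ennreal (1 / \<rho> ^ Suc ?N) * indicator {norm y<..} \<rho>) * indicator (-{0}) y \<partial>lborel)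
      = ennreal (\<rho> ^ ?N) * (\<integral>\<^sup>+x. ennreal (norm (\<rho> *\<^sub>R x) ^ ?N) * f (\<rho> *\<^sub>R x) *
          (ennreal (1 / \<rho> ^ Suc ?N) * indicator {norm (\<rho> *\<^sub>R x)<..} \<rho>) * indicator (-{0}) (\<rho> *\<^sub>R x) \<partial>lborel)"
      using True by (intro nn_integral_lborel_scaleR) (measurable, simp_all)
    also have "\<dots> = (\<integral>\<^sup>+x. ennreal (\<rho> ^ ?N) * (ennreal (norm (\<rho> *\<^sub>R x) ^ ?N) * f (\<rho> *\<^sub>R x) *
          (ennreal (1 / \<rho> ^ Suc ?N) * indicator {norm (\<rho> *\<^sub>R x)<..} \<rho>) * indicator (-{0}) (\<rho> *\<^sub>R x)) \<partial>lborel)"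
      by (subst nn_integral_cmult) (measurable, simp_all)
    also have "\<dots> = (\<integral>\<^sup>+x. ennreal (norm x ^ ?N * \<rho> ^ (?N - 1)) * ?P \<rho> * (f (\<rho> *\<^sub>R x) * ?B x) \<partial>lborel)"
    proof (intro nn_integral_cong)
      fix x :: 'a
      have ind: "indicator {norm (\<rho> *\<^sub>R x)<..} \<rho> * indicator (-{0}) (\<rho> *\<^sub>R x) = (?B x :: ennreal)"
        using True by (auto simp: indicator_def)
      have "\<rho> ^ ?N * norm (\<rho> *\<^sub>R x) ^ ?N * (1 / \<rho> ^ Suc ?N) = norm x ^ ?N * \<rho> ^ (?N - 1)"
        using True DIM_positive[where 'a='a] by (cases "DIM('a)") (auto simp: power_mult_distrib)
      then have coeff: "ennreal (\<rho> ^ ?N) * ennreal (norm (\<rho> *\<^sub>R x) ^ ?N) * ennreal (1 / \<rho> ^ Suc ?N)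
          = ennreal (norm x ^ ?N * \<rho> ^ (?N - 1))"
        using True by (simp flip: ennreal_mult del: norm_scaleR)
      have "ennreal (\<rho> ^ ?N) * (ennreal (norm (\<rho> *\<^sub>R x) ^ ?N) * f (\<rho> *\<^sub>R x) *
          (ennreal (1 / \<rho> ^ Suc ?N) * indicator {norm (\<rho> *\<^sub>R x)<..} \<rho>) * indicator (-{0}) (\<rho> *\<^sub>R x)) =
          (ennreal (\<rho> ^ ?N) * ennreal (norm (\<rho> *\<^sub>R x) ^ ?N) * ennreal (1 / \<rho> ^ Suc ?N)) *
          (f (\<rho> *\<^sub>R x) * (indicator {norm (\<rho> *\<^sub>R x)<..} \<rho> * indicator (-{0}) (\<rho> *\<^sub>R x)))"
        by (simp only: mult_ac)
      then show "ennreal (\<rho> ^ ?N) * (ennreal (norm (\<rho> *\<^sub>R x) ^ ?N) * f (\<rho> *\<^sub>R x) *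
          (ennreal (1 / \<rho> ^ Suc ?N) * indicator {norm (\<rho> *\<^sub>R x)<..} \<rho>) * indicator (-{0}) (\<rho> *\<^sub>R x)) =
          ennreal (norm x ^ ?N * \<rho> ^ (?N - 1)) * ?P \<rho> * (f (\<rho> *\<^sub>R x) * ?B x)"
        unfolding coeff ind using True by simp
    qed
    finally show ?thesis by (rule sym)
  next
    case False
    then have "indicator {norm y<..} \<rho> = (0::ennreal)" for y :: 'a
      using norm_ge_zero[of y] by (auto simp: indicator_def simp del: norm_ge_zero)
    with False show ?thesis by simp
  qed
  have "(\<integral>\<^sup>+r. (ennreal (r ^ (?N - 1)) * ?P r) * (\<integral>\<^sup>+\<omega>. f (r *\<^sub>R \<omega>) \<partial>sphere_measure) \<partial>lborel)
      = (\<integral>\<^sup>+r. of_nat ?N * (\<integral>\<^sup>+x. (ennreal (r ^ (?N - 1)) * ?P r) * (f (r *\<^sub>R sgn x) * ?B x) \<partial>lborel) \<partial>lborel)"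
  proof (intro nn_integral_cong)
    fix r :: real
    have "(\<integral>\<^sup>+x. (ennreal (r ^ (?N - 1)) * ?P r) * (f (r *\<^sub>R sgn x) * ?B x) \<partial>lborel)
        = (ennreal (r ^ (?N - 1)) * ?P r) * (\<integral>\<^sup>+x. f (r *\<^sub>R sgn x) * ?B x \<partial>lborel)"
      by (intro nn_integral_cmult) measurable
    moreover have "(\<integral>\<^sup>+\<omega>. f (r *\<^sub>R \<omega>) \<partial>sphere_measure) =
        of_nat ?N * (\<integral>\<^sup>+x. f (r *\<^sub>R sgn x) * ?B x \<partial>lborel)"
      by (intro nn_integral_sphere_measure) measurable
    ultimately show "(ennreal (r ^ (?N - 1)) * ?P r) * (\<integral>\<^sup>+\<omega>. f (r *\<^sub>R \<omega>) \<partial>sphere_measure) =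
        of_nat ?N * (\<integral>\<^sup>+x. (ennreal (r ^ (?N - 1)) * ?P r) * (f (r *\<^sub>R sgn x) * ?B x) \<partial>lborel)"
      by (simp only: mult.left_commute)
  qed
  also have "\<dots> = of_nat ?N * (\<integral>\<^sup>+r. (\<integral>\<^sup>+x. (ennreal (r ^ (?N - 1)) * ?P r) * (f (r *\<^sub>R sgn x) * ?B x) \<partial>lborel) \<partial>lborel)"
    by (intro nn_integral_cmult) measurable
  \<comment> \<open>Each of the three one-sided computations needs its own inner variable: r for
    fixed x, then x for fixed rho, then rho for fixed y. Hence Tonelli is applied three
    times.\<close>
  also have "(\<integral>\<^sup>+r. (\<integral>\<^sup>+x. (ennreal (r ^ (?N - 1)) * ?P r) * (f (r *\<^sub>R sgn x) * ?B x) \<partial>lborel) \<partial>lborel)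
      = (\<integral>\<^sup>+x. (\<integral>\<^sup>+r. (ennreal (r ^ (?N - 1)) * ?P r) * (f (r *\<^sub>R sgn x) * ?B x) \<partial>lborel) \<partial>lborel)"
    by (rule lborel_pair.Fubini') measurable
  also have "\<dots> = (\<integral>\<^sup>+x. (\<integral>\<^sup>+\<rho>. ennreal (norm x ^ ?N * \<rho> ^ (?N - 1)) * ?P \<rho> * (f (\<rho> *\<^sub>R x) * ?B x) \<partial>lborel) \<partial>lborel)"
    by (simp only: subst_r)
  also have "\<dots> = (\<integral>\<^sup>+\<rho>. (\<integral>\<^sup>+x. ennreal (norm x ^ ?N * \<rho> ^ (?N - 1)) * ?P \<rho> * (f (\<rho> *\<^sub>R x) * ?B x) \<partial>lborel) \<partial>lborel)"
    by (rule lborel_pair.Fubini') measurable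
  also have "\<dots> = (\<integral>\<^sup>+\<rho>. (\<integral>\<^sup>+y. ennreal (norm y ^ ?N) * f y *
      (ennreal (1 / \<rho> ^ Suc ?N) * indicator {norm y<..} \<rho>) * indicator (-{0}) y \<partial>lborel) \<partial>lborel)"
    by (simp only: subst_x)
  also have "\<dots> = (\<integral>\<^sup>+y. (\<integral>\<^sup>+\<rho>. ennreal (norm y ^ ?N) * f y *
      (ennreal (1 / \<rho> ^ Suc ?N) * indicator {norm y<..} \<rho>) * indicator (-{0}) y \<partial>lborel) \<partial>lborel)"
    by (rule lborel_pair.Fubini') measurable
  also have "of_nat ?N * \<dots> = (\<integral>\<^sup>+y. of_nat ?N * (\<integral>\<^sup>+\<rho>. ennreal (norm y ^ ?N) * f y *
      (ennreal (1 / \<rho> ^ Suc ?N) * indicator {norm y<..} \<rho>) * indicator (-{0}) y \<partial>lborel) \<partial>lborel)"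
    by (intro nn_integral_cmult[symmetric]) measurable
  also have "\<dots> = (\<integral>\<^sup>+y. f y \<partial>lborel)"
  proof (rule nn_integral_cong_AE, rule eventually_mono[OF AE_lborel_singleton[of 0]])
    fix y :: 'a assume "y \<noteq> 0"
    then have y: "norm y > 0" by simp
    have "(\<integral>\<^sup>+\<rho>. ennreal (norm y ^ ?N) * f y *
        (ennreal (1 / \<rho> ^ Suc ?N) * indicator {norm y<..} \<rho>) * indicator (-{0}) y \<partial>lborel)
        = ennreal (norm y ^ ?N) * f y * ennreal (1 / (real ?N * norm y ^ ?N))"
      using y by (simp add: nn_integral_cmult nn_integral_power_tail del: power_Suc)
    moreover have "of_nat ?N * (ennreal (norm y ^ ?N) * ennreal (1 / (real ?N * norm y ^ ?N))) = 1"
    proof -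
      have "of_nat ?N * (ennreal (norm y ^ ?N) * ennreal (1 / (real ?N * norm y ^ ?N)))
         = ennreal (real ?N * (norm y ^ ?N * (1 / (real ?N * norm y ^ ?N))))"
        using y by (simp add: ennreal_of_nat_eq_real_of_nat flip: ennreal_mult)
      also have "real ?N * (norm y ^ ?N * (1 / (real ?N * norm y ^ ?N))) = 1"
        using y by simp
      finally show ?thesis by simp
    qed
    ultimately show "of_nat ?N * (\<integral>\<^sup>+\<rho>. ennreal (norm y ^ ?N) * f y *
        (ennreal (1 / \<rho> ^ Suc ?N) * indicator {norm y<..} \<rho>) * indicator (-{0}) y \<partial>lborel) = f y"
      by (simp add: mult_ac)
  qed
  finally show ?thesis by (rule sym)
qed

section \<open>Polar coordinates for vector-valued integrals\<close>

lemma finite_measure_sphere_measure: "finite_measure (sphere_measure :: 'a::euclidean_space measure)"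
  by (rule finite_measureI) (simp add: sphere_measure_total)

lemma measurable_sphere_measure:
  fixes f :: "'a::euclidean_space \<Rightarrow> 'b"
  shows "f \<in> borel \<rightarrow>\<^sub>M M \<Longrightarrow> f \<in> sphere_measure \<rightarrow>\<^sub>M M"
  by (subst measurable_cong_sets[OF sets_sphere_measure refl]) (rule measurable_restrict_space1)

lemma measurable_sphere_measure_ident:
  "(\<lambda>\<omega>. \<omega>) \<in> sphere_measure \<rightarrow>\<^sub>M (borel :: 'a::euclidean_space measure)"
  by (rule measurable_sphere_measure) simp

definition radial_measure :: "nat \<Rightarrow> real measure" where
  "radial_measure n = density lborel (\<lambda>r. ennreal (r ^ (n - 1) * indicator {0<..} r))"

lemma sets_radial_measure [measurable_cong]: "sets (radial_measure n) = sets borel"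
  by (simp add: radial_measure_def)

lemma sigma_finite_radial_measure: "sigma_finite_measure (radial_measure n)"
  unfolding radial_measure_def
  by (subst sigma_finite_measure.sigma_finite_iff_density_finite[OF sigma_finite_lborel]) auto

text \<open>Stating polar coordinates as an identity of measures is what carries them from
  nonnegative to Banach-valued functions: the integral of a push-forward and Fubini for a product of
  sigma-finite measures then apply directly.\<close>

lemma lborel_eq_polar:
  "lborel = distr (radial_measure DIM('a) \<Otimes>\<^sub>M sphere_measure) borel
     (\<lambda>p. fst p *\<^sub>R (snd p :: 'a::euclidean_space))"
proof (rule measure_eqI)
  note measurable_sphere_measure_ident [measurable]
  interpret finite_measure "sphere_measure :: 'a measure"
    by (rule finite_measure_sphere_measure)
  fix A :: "'a set" assume "A \<in> sets lborel"
  then have [measurable]: "A \<in> sets borel" by simp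
  have "emeasure lborel A = (\<integral>\<^sup>+x. indicator A x \<partial>lborel)"
    by simp
  also have "\<dots> = (\<integral>\<^sup>+r. (ennreal (r ^ (DIM('a) - 1)) * indicator {0<..} r) *
      (\<integral>\<^sup>+\<omega>. indicator A (r *\<^sub>R \<omega>) \<partial>sphere_measure) \<partial>lborel)"
    by (rule nn_integral_polar) measurable
  also have "\<dots> = (\<integral>\<^sup>+r. (\<integral>\<^sup>+\<omega>. indicator A (r *\<^sub>R \<omega>) \<partial>sphere_measure) \<partial>radial_measure DIM('a))"
    unfolding radial_measure_def
    by (subst nn_integral_density) (auto intro!: nn_integral_cong simp: indicator_def)
  also have "\<dots> = (\<integral>\<^sup>+p. indicator A (fst p *\<^sub>R snd p) \<partial>(radial_measure DIM('a) \<Otimes>\<^sub>M sphere_measure))"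
    by (subst nn_integral_fst[symmetric]) simp_all
  also have "\<dots> = emeasure (distr (radial_measure DIM('a) \<Otimes>\<^sub>M sphere_measure) borel
     (\<lambda>p. fst p *\<^sub>R snd p)) A"
    by (subst nn_integral_indicator[symmetric], simp, subst nn_integral_distr) simp_all
  finally show "emeasure lborel A = \<dots>" .
qed simp

lemma integral_polar:
  fixes f :: "'a::euclidean_space \<Rightarrow> 'b::{banach, second_countable_topology}"
  assumes f: "integrable lborel f"
  shows "(\<integral>x. f x \<partial>lborel) =
    (\<integral>r. (r ^ (DIM('a) - 1) * indicator {0<..} r) *\<^sub>R (\<integral>\<omega>. f (r *\<^sub>R \<omega>) \<partial>sphere_measure) \<partial>lborel)"
proof -
  note measurable_sphere_measure_ident [measurable]
  interpret S: finite_measure "sphere_measure :: 'a measure"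
    by (rule finite_measure_sphere_measure)
  interpret R: sigma_finite_measure "radial_measure DIM('a)"
    by (rule sigma_finite_radial_measure)
  interpret pair_sigma_finite "radial_measure DIM('a)" "sphere_measure :: 'a measure" ..
  let ?P = "radial_measure DIM('a) \<Otimes>\<^sub>M (sphere_measure :: 'a measure)"
  have [measurable]: "f \<in> borel_measurable borel" using f by auto
  have m: "(\<lambda>p. fst p *\<^sub>R snd p) \<in> ?P \<rightarrow>\<^sub>M borel" by measurable
  have int: "integrable ?P (\<lambda>p. f (fst p *\<^sub>R snd p))"
    using f by (subst (asm) lborel_eq_polar, subst (asm) integrable_distr_eq[OF m]) auto
  have "(\<integral>x. f x \<partial>lborel) = (\<integral>p. f (fst p *\<^sub>R snd p) \<partial>?P)"
    by (subst lborel_eq_polar, subst integral_distr[OF m]) auto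
  also have "\<dots> = (\<integral>r. (\<integral>\<omega>. f (r *\<^sub>R \<omega>) \<partial>sphere_measure) \<partial>radial_measure DIM('a))"
    using integral_fst'[OF int] by simp
  also have "\<dots> = (\<integral>r. (r ^ (DIM('a) - 1) * indicator {0<..} r) *\<^sub>R (\<integral>\<omega>. f (r *\<^sub>R \<omega>) \<partial>sphere_measure) \<partial>lborel)"
    unfolding radial_measure_def
    by (subst integral_density) (auto simp: indicator_def)
  finally show ?thesis .
qed

section \<open>Spherical means and radial Gaussian weights\<close>

text \<open>Dominated convergence along sequences of radii: on the unit sphere the integrand is
  bounded by \<open>K\<close>, which is integrable because the surface measure is finite.\<close>

lemma continuous_on_sphere_mean:
  fixes u0 :: "'a::euclidean_space \<Rightarrow> real"
  assumes cont: "continuous_on UNIV u0" and bound: "\<And>x. \<bar>u0 x\<bar> \<le> K"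
  shows "continuous_on UNIV (\<lambda>r. \<integral>\<omega>. u0 (r *\<^sub>R \<omega>) *\<^sub>R \<omega> \<partial>sphere_measure)"
  unfolding continuous_on_eq_continuous_at[OF open_UNIV]
proof
  interpret finite_measure "sphere_measure :: 'a measure"
    by (rule finite_measure_sphere_measure)
  have [measurable]: "u0 \<in> borel_measurable borel"
    using cont by (rule borel_measurable_continuous_onI)
  fix r :: real
  show "isCont (\<lambda>r. \<integral>\<omega>. u0 (r *\<^sub>R \<omega>) *\<^sub>R \<omega> \<partial>sphere_measure) r"
    unfolding continuous_at_sequentially o_def
  proof (intro allI impI)
    fix R :: "nat \<Rightarrow> real" assume R: "R \<longlonglongrightarrow> r"
    show "(\<lambda>n. \<integral>\<omega>. u0 (R n *\<^sub>R \<omega>) *\<^sub>R \<omega> \<partial>sphere_measure) \<longlonglongrightarrow>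
        (\<integral>\<omega>. u0 (r *\<^sub>R \<omega>) *\<^sub>R \<omega> \<partial>sphere_measure)"
    proof (rule integral_dominated_convergence[where w="\<lambda>_. K"])
      show "AE \<omega> in sphere_measure. (\<lambda>n. u0 (R n *\<^sub>R \<omega>) *\<^sub>R \<omega>) \<longlonglongrightarrow> u0 (r *\<^sub>R \<omega>) *\<^sub>R \<omega>"
        using cont
        by (intro AE_I2 tendsto_scaleR tendsto_const continuous_on_tendsto_compose[of UNIV u0] R) auto
      show "AE \<omega> in sphere_measure. norm (u0 (R n *\<^sub>R \<omega>) *\<^sub>R \<omega>) \<le> K" for n
        using bound by (intro AE_I2) auto
    qed (auto intro!: measurable_sphere_measure)
  qed
qed

text \<open>The test function for the converse direction is a component of the spherical mean itself.\<close>

lemma sphere_mean_eq_0_iff: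
  fixes u0 :: "'a::euclidean_space \<Rightarrow> real"
  assumes cont: "continuous_on UNIV u0" and supp: "\<And>x. L \<le> norm x \<Longrightarrow> u0 x = 0"
    and int: "integrable lborel (\<lambda>y. u0 y *\<^sub>R y)"
  shows "(\<forall>r\<ge>0. (\<integral>\<omega>. u0 (r *\<^sub>R \<omega>) *\<^sub>R \<omega> \<partial>sphere_measure) = 0) \<longleftrightarrow>
    (\<forall>a>0. (\<integral>y. exp (- a * norm y powr 2) *\<^sub>R (u0 y *\<^sub>R y) \<partial>lborel) = 0)"
proof -
  define \<Psi> where "\<Psi> r = (\<integral>\<omega>. u0 (r *\<^sub>R \<omega>) *\<^sub>R \<omega> \<partial>sphere_measure)" for r
  have [measurable]: "u0 \<in> borel_measurable borel"
    using cont by (rule borel_measurable_continuous_onI)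
  \<comment> \<open>A radial weight is constant on each sphere and leaves the inner integral; the
    additional factor \<open>r\<close> comes from y = r omega.\<close>
  have polar: "(\<integral>y. h (norm y) *\<^sub>R (u0 y *\<^sub>R y) \<partial>lborel) =
      (\<integral>r. (r ^ (DIM('a) - 1) * indicator {0<..} r) *\<^sub>R ((h r * r) *\<^sub>R \<Psi> r) \<partial>lborel)"
    if h: "integrable lborel (\<lambda>y. h (norm y) *\<^sub>R (u0 y *\<^sub>R y))" for h
  proof -
    have "(\<integral>y. h (norm y) *\<^sub>R (u0 y *\<^sub>R y) \<partial>lborel) = (\<integral>r. (r ^ (DIM('a) - 1) * indicator {0<..} r) *\<^sub>R
        (\<integral>\<omega>. h (norm (r *\<^sub>R \<omega>)) *\<^sub>R (u0 (r *\<^sub>R \<omega>) *\<^sub>R (r *\<^sub>R \<omega>)) \<partial>sphere_measure) \<partial>lborel)"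
      by (rule integral_polar[OF h])
    also have "\<dots> = (\<integral>r. (r ^ (DIM('a) - 1) * indicator {0<..} r) *\<^sub>R ((h r * r) *\<^sub>R \<Psi> r) \<partial>lborel)"
    proof (rule Bochner_Integration.integral_cong)
      fix r :: real
      have "(\<integral>\<omega>. h (norm (r *\<^sub>R \<omega>)) *\<^sub>R (u0 (r *\<^sub>R \<omega>) *\<^sub>R (r *\<^sub>R \<omega>)) \<partial>sphere_measure) = (h r * r) *\<^sub>R \<Psi> r"
        if "r > 0"
      proof -
        have "(\<integral>\<omega>. h (norm (r *\<^sub>R \<omega>)) *\<^sub>R (u0 (r *\<^sub>R \<omega>) *\<^sub>R (r *\<^sub>R \<omega>)) \<partial>sphere_measure)
            = (\<integral>\<omega>. (h r * r) *\<^sub>R (u0 (r *\<^sub>R \<omega>) *\<^sub>R \<omega>) \<partial>sphere_measure)"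
          using that by (intro Bochner_Integration.integral_cong) (auto simp: mult_ac)
        also have "\<dots> = (h r * r) *\<^sub>R \<Psi> r"
          unfolding \<Psi>_def by (cases "h r * r = 0") (simp_all del: scaleR_scaleR mult_eq_0_iff)
        finally show ?thesis .
      qed
      then show "(r ^ (DIM('a) - 1) * indicator {0<..} r) *\<^sub>R
        (\<integral>\<omega>. h (norm (r *\<^sub>R \<omega>)) *\<^sub>R (u0 (r *\<^sub>R \<omega>) *\<^sub>R (r *\<^sub>R \<omega>)) \<partial>sphere_measure) =
        (r ^ (DIM('a) - 1) * indicator {0<..} r) *\<^sub>R ((h r * r) *\<^sub>R \<Psi> r)"
        by (cases "r > 0") auto
    qed simp
    finally show ?thesis .
  qed
  have int_exp: "integrable lborel (\<lambda>y. exp (- a * norm y powr 2) *\<^sub>R (u0 y *\<^sub>R y))" if "a > 0" for a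
  proof (rule Bochner_Integration.integrable_bound[OF int])
    show "AE y in lborel. norm (exp (- a * norm y powr 2) *\<^sub>R (u0 y *\<^sub>R y)) \<le> norm (u0 y *\<^sub>R y)"
      using that unfolding norm_scaleR[of "exp _"]
      by (intro AE_I2 mult_left_le_one_le) auto
  qed measurable
  have "(\<integral>y. exp (- a * norm y powr 2) *\<^sub>R (u0 y *\<^sub>R y) \<partial>lborel) = 0"
    if \<Psi>: "\<forall>r\<ge>0. \<Psi> r = 0" and "a > 0" for a
  proof -
    have "(\<integral>y. exp (- a * norm y powr 2) *\<^sub>R (u0 y *\<^sub>R y) \<partial>lborel) =
      (\<integral>r. (r ^ (DIM('a) - 1) * indicator {0<..} r) *\<^sub>R ((exp (- a * r powr 2) * r) *\<^sub>R \<Psi> r) \<partial>lborel)"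
      using int_exp[OF \<open>a > 0\<close>] by (rule polar)
    also have "\<dots> = (\<integral>r. 0 \<partial>(lborel :: real measure))"
      using \<Psi> by (intro Bochner_Integration.integral_cong) (auto simp: indicator_def)
    finally show ?thesis by simp
  qed
  moreover have "\<forall>r\<ge>0. \<Psi> r = 0"
    if zero: "\<forall>a>0. (\<integral>y. exp (- a * norm y powr 2) *\<^sub>R (u0 y *\<^sub>R y) \<partial>lborel) = 0"
  proof -
    have "compact (u0 ` cball 0 L)"
      using cont by (intro compact_continuous_image) (auto intro: continuous_on_subset)
    then obtain K where K: "\<And>x. x \<in> cball 0 L \<Longrightarrow> \<bar>u0 x\<bar> \<le> K"
      using compact_imp_bounded by (fastforce simp: bounded_iff)
    have "\<bar>u0 x\<bar> \<le> max K 0" for x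
      using K[of x] supp[of x] by (cases "norm x \<le> L") auto
    then have cont\<Psi>: "continuous_on UNIV \<Psi>"
      unfolding \<Psi>_def using cont by (rule continuous_on_sphere_mean[rotated])
    have \<Psi>_supp: "\<Psi> r = 0" if "r \<ge> max L 0" for r
    proof -
      have "\<Psi> r = (\<integral>\<omega>. 0 \<partial>(sphere_measure :: 'a measure))"
        unfolding \<Psi>_def using that supp by (intro Bochner_Integration.integral_cong) auto
      then show ?thesis by simp
    qed
    have \<Psi>_pos: "\<Psi> r \<bullet> j = 0" if "r > 0" for r j
    proof -
      define g where "g r = \<Psi> r \<bullet> j" for r
      have contg: "continuous_on UNIV g"
        unfolding g_def by (intro continuous_intros cont\<Psi>)
      then have [measurable]: "g \<in> borel_measurable borel"
        by (rule borel_measurable_continuous_onI)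
      \<comment> \<open>The growing factor undoes the Gaussian with a = 1, so that the weighted
        integral becomes the one against \<open>g\<close> itself. It is admissible because
        \<open>g\<close> vanishes beyond \<open>max L 0\<close>, which gives \<open>?h\<close> the
        limit 0.\<close>
      let ?h = "\<lambda>r. exp (r powr 2) * g r"
      have conth: "continuous_on {0..} ?h"
        by (intro continuous_intros continuous_on_powr' continuous_on_subset[OF contg]) auto
      have limh: "(?h \<longlongrightarrow> 0) at_top"
        using \<Psi>_supp by (intro tendsto_eventually eventually_mono[OF eventually_ge_at_top[of "max L 0"]])
          (auto simp: g_def)
      have "(\<integral>y. (exp (- 1 * norm y powr 2) * ?h (norm y)) *\<^sub>R (u0 y *\<^sub>R y) \<partial>lborel) = 0"
      proof (rule integral_weight_eq_0[OF _ _ _ _ _ _ conth limh])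
        show "(\<integral>y. exp (- (real (Suc k) * 1) * norm y powr 2) *\<^sub>R (u0 y *\<^sub>R y) \<partial>lborel) = 0" for k
          by (rule zero[rule_format]) simp
      qed (use int_exp[of 1] in auto)
      moreover have "exp (- 1 * s powr 2) * ?h s = g s" for s :: real
        by (simp add: exp_minus)
      ultimately have g0: "(\<integral>y. g (norm y) *\<^sub>R (u0 y *\<^sub>R y) \<partial>lborel) = 0"
        by (simp only:)
      have "compact (g ` {0..max L 0})"
        by (intro compact_continuous_image continuous_on_subset[OF contg]) auto
      then obtain G where G: "\<And>r. 0 \<le> r \<Longrightarrow> r \<le> max L 0 \<Longrightarrow> \<bar>g r\<bar> \<le> G"
        using compact_imp_bounded by (fastforce simp: bounded_iff)
      have G': "\<bar>g r\<bar> \<le> G" if "0 \<le> r" for r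
        using G[of r] G[of 0] that \<Psi>_supp[of r] by (cases "r \<le> max L 0") (auto simp: g_def)
      have intg: "integrable lborel (\<lambda>y. g (norm y) *\<^sub>R (u0 y *\<^sub>R y))"
      proof (rule Bochner_Integration.integrable_bound[OF integrable_scaleR_right[OF int, of G]])
        have "\<bar>g (norm y)\<bar> \<le> \<bar>G\<bar>" for y :: 'a
          using G'[of "norm y"] by simp
        then show "AE y in lborel. norm (g (norm y) *\<^sub>R (u0 y *\<^sub>R y)) \<le> norm (G *\<^sub>R (u0 y *\<^sub>R y))"
          unfolding norm_scaleR[of "g _"] norm_scaleR[of G] by (intro AE_I2 mult_right_mono) auto
      qed measurable
      \<comment> \<open>\<open>max 0 r ^ DIM('a)\<close> merges the polar weight, its indicator and
        the extra factor \<open>r\<close> into one continuous function. Its component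
        \<open>\<phi>\<close> is r^N times the square of \<open>g\<close> for r > 0 and 0 otherwise,
        so a vanishing integral gives \<open>\<phi> r = 0\<close> almost everywhere, and by
        continuity everywhere.\<close>
      define V where "V r = (max 0 r ^ DIM('a) * g r) *\<^sub>R \<Psi> r" for r
      define \<phi> where "\<phi> r = V r \<bullet> j" for r
      have \<phi>: "\<phi> r = max 0 r ^ DIM('a) * (g r)\<^sup>2" for r
        by (simp add: \<phi>_def V_def g_def power2_eq_square)
      have V_eq: "V r = (r ^ (DIM('a) - 1) * indicator {0<..} r) *\<^sub>R ((g r * r) *\<^sub>R \<Psi> r)" for r
        using DIM_positive[where 'a='a]
        by (cases "DIM('a)") (auto simp: V_def indicator_def max_def mult_ac)
      have contV: "continuous_on UNIV V"
        unfolding V_def by (intro continuous_intros contg cont\<Psi>)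
      then have cont\<phi>: "continuous_on UNIV \<phi>"
        unfolding \<phi>_def by (intro continuous_intros)
      have "continuous_on {0..max L 0} V"
        using contV by (rule continuous_on_subset) simp
      then have "integrable lborel (\<lambda>r. indicator {0..max L 0} r *\<^sub>R V r)"
        by (intro borel_integrable_compact) auto
      also have "(\<lambda>r. indicator {0..max L 0} r *\<^sub>R V r) = V"
      proof
        fix r show "indicator {0..max L 0} r *\<^sub>R V r = V r"
          using \<Psi>_supp[of r] by (cases "0 \<le> r"; cases "r \<le> max L 0") (auto simp: V_def)
      qed
      finally have intV: "integrable lborel V" .
      then have int\<phi>: "integrable lborel \<phi>"
        unfolding \<phi>_def by (rule integrable_inner_left[rotated])
      have "0 = (\<integral>r. V r \<partial>lborel) \<bullet> j"
        using polar[OF intg] g0 by (simp add: V_eq)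
      also have "\<dots> = (\<integral>r. \<phi> r \<partial>lborel)"
        unfolding \<phi>_def using intV by simp
      finally have "(\<integral>r. \<phi> r \<partial>lborel) = 0" by simp
      then have "AE r in lborel. \<phi> r = 0"
        using int\<phi> by (subst (asm) integral_nonneg_eq_0_iff_AE) (auto simp: \<phi>)
      then have "AE r in lebesgue. r \<in> {r. \<phi> r = 0}"
        by (auto intro: AE_completion)
      moreover have "closed {r. \<phi> r = 0}"
        by (intro closed_Collect_eq cont\<phi> continuous_on_const)
      ultimately have "r \<in> {r. \<phi> r = 0}"
        by (rule mem_closed_if_AE_lebesgue[rotated])
      then show ?thesis using \<open>r > 0\<close> by (simp add: \<phi> g_def)
    qed
    have \<Psi>_pos: "\<Psi> r = 0" if "r > 0" for r
      using \<Psi>_pos[OF that] by (metis inner_eq_zero_iff)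
    \<comment> \<open>The argument divided by r^N, so the radius 0 is recovered separately, by
      continuity.\<close>
    have "closure {0<..} \<subseteq> {r. \<Psi> r = 0}"
      using \<Psi>_pos by (intro closure_minimal closed_Collect_eq cont\<Psi> continuous_on_const) auto
    then show ?thesis by auto
  qed
  ultimately show ?thesis unfolding \<Psi>_def by blast
qed

section \<open>Integrals of cosines and Gaussians\<close>

text \<open>Expanding only \<open>cos d\<close> and \<open>sin d\<close> at 0 and then applying the
  addition formula keeps the bound uniform in \<open>x\<close>; each of the two remainders
  contributes at most d^2/2.\<close>

lemma cos_taylor_bound: "\<bar>cos (x + d) - cos x + d * sin x\<bar> \<le> d\<^sup>2" for x d :: real
proof -
  have "\<exists>t. cos d = (\<Sum>m<2. cos_coeff m * d ^ m) + (cos (t + 1 / 2 * real 2 * pi) / fact 2) * d ^ 2"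
    using Maclaurin_cos_expansion[of d 2] by blast
  then obtain t where t: "cos d = 1 - cos t / 2 * d^2"
    by (auto simp: cos_coeff_def numeral_2_eq_2 )
  have "\<exists>t. sin d = (\<Sum>m<2. sin_coeff m * d ^ m) + (sin (t + 1 / 2 * real 2 * pi) / fact 2) * d ^ 2"
    using Maclaurin_sin_expansion[of d 2] by blast
  then obtain t' where t': "sin d = d - sin t' / 2 * d^2"
    by (auto simp: sin_coeff_def numeral_2_eq_2)
  have "cos (x + d) - cos x + d * sin x = (sin t' * sin x - cos t * cos x) / 2 * d^2"
    unfolding cos_add t t' by (simp add: field_simps)
  also have "\<bar>\<dots>\<bar> \<le> 1 * d^2"
  proof -
    have "\<bar>sin t' * sin x\<bar> \<le> 1" "\<bar>cos t * cos x\<bar> \<le> 1"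
      by (auto simp: abs_mult intro!: mult_le_one)
    then have "\<bar>(sin t' * sin x - cos t * cos x) / 2\<bar> \<le> 1" by simp
    then show ?thesis unfolding abs_mult by (intro mult_mono) auto
  qed
  finally show ?thesis by simp
qed

text \<open>Integrating the uniform Taylor bound gives a remainder of at most
  \<open>K * (norm h)\<^sup>2\<close>, hence the full Frechet derivative at once; this is where the
  second moment enters. The free phase \<open>b\<close> lets the lemma serve both the convolution
  with \<open>u0\<close> and the bare Gaussian (phase 0).\<close>

lemma GDERIV_integral_cos:
  fixes v :: "'p \<Rightarrow> 'a::euclidean_space" and c b :: "'p \<Rightarrow> real"
  assumes [measurable]: "v \<in> borel_measurable M" "b \<in> borel_measurable M"
    and c0: "integrable M c" and c1: "integrable M (\<lambda>p. c p * norm (v p))"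
    and c2: "integrable M (\<lambda>p. c p * (norm (v p))\<^sup>2)"
  shows "GDERIV (\<lambda>x. \<integral>p. c p * cos (x \<bullet> v p + b p) \<partial>M) x :>
           - (\<integral>p. (c p * sin (x \<bullet> v p + b p)) *\<^sub>R v p \<partial>M)"
proof -
  have [measurable]: "c \<in> borel_measurable M" using c0 by auto
  define D where "D = - (\<integral>p. (c p * sin (x \<bullet> v p + b p)) *\<^sub>R v p \<partial>M)"
  define K where "K = (\<integral>p. \<bar>c p * (norm (v p))\<^sup>2\<bar> \<partial>M)"
  define f where "f x = (\<integral>p. c p * cos (x \<bullet> v p + b p) \<partial>M)" for x
  have int1: "integrable M (\<lambda>p. c p * cos (x \<bullet> v p + b p))" for x
    by (rule Bochner_Integration.integrable_bound[OF c0])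
       (auto simp: abs_mult intro!: mult_right_le_one_le)
  have int2: "integrable M (\<lambda>p. (c p * sin (x \<bullet> v p + b p)) *\<^sub>R v p)"
    by (rule Bochner_Integration.integrable_bound[OF c1])
       (auto simp: abs_mult intro!: AE_I2 mult_right_mono mult_right_le_one_le)
  have bound: "\<bar>f (x + h) - f x - h \<bullet> D\<bar> \<le> K * (norm h)\<^sup>2" for h
  proof -
    have hD: "h \<bullet> D = - (\<integral>p. h \<bullet> ((c p * sin (x \<bullet> v p + b p)) *\<^sub>R v p) \<partial>M)"
      using int2 by (simp add: D_def del: inner_scaleR_right)
    have int3: "integrable M (\<lambda>p. h \<bullet> ((c p * sin (x \<bullet> v p + b p)) *\<^sub>R v p))"
      using int2 by (intro integrable_inner_right) auto
    have "f (x + h) - f x - h \<bullet> D =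
        (\<integral>p. c p * cos ((x + h) \<bullet> v p + b p) - c p * cos (x \<bullet> v p + b p)
              + h \<bullet> ((c p * sin (x \<bullet> v p + b p)) *\<^sub>R v p) \<partial>M)"
      unfolding hD f_def using int1 int3 by simp
    also have "\<bar>\<dots>\<bar> \<le> (\<integral>p. \<bar>c p * (norm (v p))\<^sup>2\<bar> * (norm h)\<^sup>2 \<partial>M)"
      unfolding real_norm_def[symmetric]
    proof (intro order_trans[OF integral_norm_bound] integral_mono integrable_norm)
      fix p
      have "c p * cos ((x + h) \<bullet> v p + b p) - c p * cos (x \<bullet> v p + b p)
              + h \<bullet> ((c p * sin (x \<bullet> v p + b p)) *\<^sub>R v p)
        = c p * (cos ((x \<bullet> v p + b p) + h \<bullet> v p) - cos (x \<bullet> v p + b p) + (h \<bullet> v p) * sin (x \<bullet> v p + b p))"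
        by (simp add: algebra_simps inner_add_left)
      also have "norm \<dots> \<le> \<bar>c p\<bar> * (h \<bullet> v p)\<^sup>2"
        unfolding real_norm_def abs_mult by (intro mult_left_mono cos_taylor_bound) auto
      also have "(h \<bullet> v p)\<^sup>2 \<le> (norm h * norm (v p))\<^sup>2"
        using Cauchy_Schwarz_ineq2[of h "v p"] by (metis abs_ge_zero power2_abs power_mono)
      finally have "norm (c p * cos ((x + h) \<bullet> v p + b p) - c p * cos (x \<bullet> v p + b p)
              + h \<bullet> ((c p * sin (x \<bullet> v p + b p)) *\<^sub>R v p)) \<le> \<bar>c p\<bar> * (norm h * norm (v p))\<^sup>2"
        by (simp add: mult_left_mono)
      then show "norm (c p * cos ((x + h) \<bullet> v p + b p) - c p * cos (x \<bullet> v p + b p)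
              + h \<bullet> ((c p * sin (x \<bullet> v p + b p)) *\<^sub>R v p)) \<le> norm (c p * (norm (v p))\<^sup>2) * (norm h)\<^sup>2"
        by (simp add: abs_mult power_mult_distrib mult_ac)
    qed (use int1 int3 integrable_abs[OF c2] in \<open>auto simp: abs_mult\<close>)
    finally show ?thesis by (simp add: K_def)
  qed
  have "(f has_derivative (\<lambda>h. h \<bullet> D)) (at x)"
    unfolding has_derivative_at
  proof
    show "bounded_linear (\<lambda>h. h \<bullet> D)" by (rule bounded_linear_inner_left)
    show "(\<lambda>h. norm (f (x + h) - f x - h \<bullet> D) / norm h) \<midarrow>0\<rightarrow> 0"
    proof (rule Lim_null_comparison[of _ "\<lambda>h. K * norm h"])
      show "\<forall>\<^sub>F h in at 0. norm (norm (f (x + h) - f x - h \<bullet> D) / norm h) \<le> K * norm h"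
        using bound by (auto simp: eventually_at_filter divide_le_eq power2_eq_square mult.assoc)
      show "((\<lambda>h. K * norm h) \<longlongrightarrow> 0) (at 0)"
        by (auto intro!: tendsto_eq_intros)
    qed
  qed
  then show ?thesis
    unfolding gderiv_def f_def D_def .
qed

lemma GDERIV_unique:
  assumes "GDERIV f x :> D" "GDERIV f x :> E"
  shows "D = E"
proof -
  have "(\<lambda>h. h \<bullet> D) = (\<lambda>h. h \<bullet> E)"
    using assms unfolding gderiv_def by (rule has_derivative_unique)
  then show ?thesis
    by (metis inner_commute vector_eq_rdot)
qed

section \<open>The Fourier transform of a Gaussian\<close>

lemma
  fixes f :: "'a::euclidean_space \<Rightarrow> real \<Rightarrow> 'c::{real_normed_field, banach, second_countable_topology}"
  assumes int: "\<And>b. b \<in> Basis \<Longrightarrow> integrable lborel (f b)"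
  shows integrable_lborel_prod: "integrable lborel (\<lambda>x. \<Prod>b\<in>Basis. f b (x \<bullet> b))"
    and integral_lborel_prod:
      "(\<integral>x. (\<Prod>b\<in>Basis. f b (x \<bullet> b)) \<partial>lborel) = (\<Prod>b\<in>Basis. \<integral>x. f b x \<partial>lborel)"
proof -
  interpret product_sigma_finite "\<lambda>_::'a. lborel :: real measure" ..
  have [measurable]: "f b \<in> borel_measurable borel" if "b \<in> Basis" for b
    using int[OF that] by auto
  have eq: "(\<Prod>b\<in>Basis. f b ((\<Sum>c\<in>Basis. x c *\<^sub>R c) \<bullet> b)) = (\<Prod>b\<in>Basis. f b (x b))" for x
    by simp
  have m1: "(\<lambda>x. \<Prod>b\<in>Basis. f b (x \<bullet> b)) \<in> borel_measurable borel"
    by measurable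
  have m2: "(\<lambda>f. \<Sum>b\<in>Basis. f b *\<^sub>R b) \<in> (\<Pi>\<^sub>M b\<in>Basis. lborel) \<rightarrow>\<^sub>M (borel :: 'a measure)"
    by measurable
  show "integrable lborel (\<lambda>x. \<Prod>b\<in>Basis. f b (x \<bullet> b))"
    by (subst lborel_eq, subst integrable_distr_eq[OF m2 m1], unfold eq)
       (intro product_integrable_prod int finite_Basis)
  show "(\<integral>x. (\<Prod>b\<in>Basis. f b (x \<bullet> b)) \<partial>lborel) = (\<Prod>b\<in>Basis. \<integral>x. f b x \<partial>lborel)"
    by (subst lborel_eq, subst integral_distr[OF m2 m1], unfold eq)
       (intro product_integral_prod int finite_Basis)
qed

lemma
  fixes \<tau> b :: real
  assumes "\<tau> > 0"
  shows integrable_gaussian_iexp: "integrable lborel (\<lambda>x. exp (- \<tau> * x\<^sup>2) * iexp (b * x))"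
    and integral_gaussian_iexp: "(\<integral>x. exp (- \<tau> * x\<^sup>2) * iexp (b * x) \<partial>lborel) =
      complex_of_real (sqrt (pi / \<tau>) * exp (- b\<^sup>2 / (4 * \<tau>)))"
proof -
  \<comment> \<open>Chosen so that \<open>\<tau> * (c * x)\<^sup>2 = x\<^sup>2 / 2\<close>: after
    rescaling, the integral is a characteristic function of the standard normal
    distribution.\<close>
  define c where "c = 1 / sqrt (2 * \<tau>)"
  have c: "c > 0" "c\<^sup>2 = 1 / (2 * \<tau>)"
    using assms by (auto simp: c_def power_divide)
  define g where "g x = exp (- \<tau> * x\<^sup>2) * iexp (b * x)" for x
  have eq: "g (0 + c * x) = sqrt (2 * pi) *\<^sub>R (std_normal_density x *\<^sub>R iexp ((b * c) * x))" for x
  proof -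
    have "\<tau> * (c * x)\<^sup>2 = x\<^sup>2 / 2"
      using assms c by (simp add: power_mult_distrib)
    then have "g (0 + c * x) = exp (- x\<^sup>2 / 2) *\<^sub>R iexp ((b * c) * x)"
      by (simp add: g_def scaleR_conv_of_real mult.assoc)
    then show ?thesis
      by (simp add: std_normal_density_def)
  qed
  have int: "integrable lborel (\<lambda>x. std_normal_density x *\<^sub>R iexp ((b * c) * x))"
    by (rule Bochner_Integration.integrable_bound[OF integrable_normal_density[of 1 0]]) auto
  then have "integrable lborel (\<lambda>x. g (0 + c * x))"
    unfolding eq by (rule integrable_scaleR_right)
  then show "integrable lborel g"
    using c by (subst (asm) lborel_integrable_real_affine_iff) auto
  have "(\<integral>x. g x \<partial>lborel) = c *\<^sub>R (\<integral>x. g (0 + c * x) \<partial>lborel)"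
    using c by (subst lborel_integral_real_affine[of c _ 0]) auto
  also have "(\<integral>x. g (0 + c * x) \<partial>lborel) =
      sqrt (2 * pi) *\<^sub>R (\<integral>x. std_normal_density x *\<^sub>R iexp ((b * c) * x) \<partial>lborel)"
    unfolding eq by (intro integral_scaleR_right int)
  also have "(\<integral>x. std_normal_density x *\<^sub>R iexp ((b * c) * x) \<partial>lborel) =
      char std_normal_distribution (b * c)"
    unfolding char_def by (subst integral_density) auto
  also have "\<dots> = of_real (exp (- b\<^sup>2 / (4 * \<tau>)))"
    using c assms by (simp add: char_std_normal_distribution power_mult_distrib)
  finally show "(\<integral>x. g x \<partial>lborel) = of_real (sqrt (pi / \<tau>) * exp (- b\<^sup>2 / (4 * \<tau>)))"
    using assms by (simp add: c_def scaleR_conv_of_real real_sqrt_divide real_sqrt_mult)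
qed

text \<open>The complex exponential, unlike the cosine, factorises over the coordinates, so the
  computation runs with \<open>iexp\<close> and takes the real part last.\<close>

lemma fourier_gaussian:
  fixes x :: "'a::euclidean_space"
  assumes "\<tau> > 0"
  shows "(\<integral>\<xi>. exp (- \<tau> * (norm \<xi>)\<^sup>2) * cos (x \<bullet> \<xi>) \<partial>lborel) =
    sqrt (pi / \<tau>) ^ DIM('a) * exp (- (norm x)\<^sup>2 / (4 * \<tau>))"
proof -
  define g where "g b y = exp (- \<tau> * y\<^sup>2) * iexp ((x \<bullet> b) * y)" for b y
  have int: "integrable lborel (g b)" for b
    using assms unfolding g_def by (rule integrable_gaussian_iexp)
  have norm2: "(norm z)\<^sup>2 = (\<Sum>b\<in>Basis. (z \<bullet> b)\<^sup>2)" for z :: 'a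
    unfolding power2_norm_eq_inner by (subst euclidean_inner) (simp add: power2_eq_square)
  have prod: "(\<Prod>b\<in>Basis. g b (\<xi> \<bullet> b)) = exp (- \<tau> * (norm \<xi>)\<^sup>2) * iexp (x \<bullet> \<xi>)" for \<xi> :: 'a
  proof -
    have "(\<Prod>b\<in>Basis. complex_of_real (exp (- \<tau> * (\<xi> \<bullet> b)\<^sup>2))) = of_real (exp (- \<tau> * (norm \<xi>)\<^sup>2))"
      by (simp add: norm2 sum_distrib_left exp_sum flip: sum_negf of_real_prod)
    moreover have "(\<Prod>b\<in>Basis. iexp ((x \<bullet> b) * (\<xi> \<bullet> b))) = iexp (x \<bullet> \<xi>)"
      by (simp add: euclidean_inner[of x \<xi>] sum_distrib_left exp_sum)
    ultimately show ?thesis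
      by (simp only: g_def prod.distrib)
  qed
  have "(\<integral>\<xi>. exp (- \<tau> * (norm \<xi>)\<^sup>2) * iexp (x \<bullet> \<xi>) \<partial>lborel) = (\<Prod>b\<in>Basis. \<integral>y. g b y \<partial>lborel)"
    using integral_lborel_prod[of g] int by (simp add: prod)
  also have "\<dots> = (\<Prod>b\<in>Basis. complex_of_real (sqrt (pi / \<tau>) * exp (- (x \<bullet> b)\<^sup>2 / (4 * \<tau>))))"
    unfolding g_def by (intro prod.cong refl integral_gaussian_iexp assms)
  also have "\<dots> = of_real (sqrt (pi / \<tau>) ^ DIM('a) * exp (- (norm x)\<^sup>2 / (4 * \<tau>)))"
    by (simp add: norm2 prod.distrib sum_divide_distrib exp_sum flip: sum_negf of_real_prod)
  finally have "Re (\<integral>\<xi>. exp (- \<tau> * (norm \<xi>)\<^sup>2) * iexp (x \<bullet> \<xi>) \<partial>lborel) =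
      sqrt (pi / \<tau>) ^ DIM('a) * exp (- (norm x)\<^sup>2 / (4 * \<tau>))"
    by simp
  also have "Re (\<integral>\<xi>. exp (- \<tau> * (norm \<xi>)\<^sup>2) * iexp (x \<bullet> \<xi>) \<partial>lborel) =
      (\<integral>\<xi>. exp (- \<tau> * (norm \<xi>)\<^sup>2) * cos (x \<bullet> \<xi>) \<partial>lborel)"
    using integrable_lborel_prod[of g] int by (subst integral_Re[symmetric]) (simp_all add: prod Re_exp)
  finally show ?thesis .
qed

section \<open>Moments of the exponential weights\<close>

text \<open>A single term of the exponential series suffices: y^n <= n! e^y with y = a r^p, where
  \<open>n\<close> is taken so large that r^m <= (y/a)^n for r > 1. The summand 1 in the bound takes
  care of r <= 1.\<close>

lemma power_mult_exp_powr_bounded: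
  fixes a p :: real
  assumes "a > 0" "p > 0"
  obtains C where "\<And>r. r \<ge> 0 \<Longrightarrow> r ^ m * exp (- a * r powr p) \<le> C"
proof -
  obtain n :: nat where n: "real m \<le> p * real n"
    using reals_Archimedean2[of "real m / p"] assms by (metis less_imp_le mult.commute pos_divide_less_eq)
  have "r ^ m * exp (- a * r powr p) \<le> 1 + fact n / a ^ n" if "r \<ge> 0" for r
  proof (cases "r \<le> 1")
    case True
    then have "r ^ m * exp (- a * r powr p) \<le> 1 * 1"
      using that assms by (intro mult_mono) (auto simp: power_le_one)
    then show ?thesis using assms by (simp add: add_increasing2)
  next
    case False
    define y where "y = a * r powr p"
    have y: "y > 0" using False assms by (simp add: y_def)
    have "r ^ m = r powr real m" using False by (simp add: powr_realpow)
    also have "\<dots> \<le> r powr (p * real n)" using n False by (intro powr_mono) auto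
    also have "\<dots> = (y / a) ^ n" using assms False by (simp add: y_def powr_powr flip: powr_realpow)
    finally have "r ^ m \<le> y ^ n / a ^ n" by (simp add: power_divide)
    have "y ^ n \<le> fact n * exp y"
    proof -
      have "(\<Sum>k\<in>{n}. y ^ k /\<^sub>R fact k) \<le> (\<Sum>k. y ^ k /\<^sub>R fact k)"
        using y by (intro sum_le_suminf summable_exp_generic) auto
      then show ?thesis by (simp add: exp_def field_simps)
    qed
    then have "y ^ n * exp (- y) \<le> fact n" by (simp add: exp_minus field_simps)
    then have "y ^ n * exp (- y) / a ^ n \<le> fact n / a ^ n"
      using assms by (intro divide_right_mono) auto
    moreover have "r ^ m * exp (- y) \<le> y ^ n / a ^ n * exp (- y)"
      using \<open>r ^ m \<le> y ^ n / a ^ n\<close> by (intro mult_right_mono) auto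
    ultimately have "r ^ m * exp (- y) \<le> fact n / a ^ n" by simp
    then show ?thesis by (simp add: y_def)
  qed
  then show ?thesis using that by blast
qed

text \<open>The majorant is a product of one-dimensional functions 1/(1 + t^2), integrable
  coordinate by coordinate. Each factor 1 + (x . b)^2 is at most 1 + |x|^2, whence the power
  \<open>DIM('a)\<close>.\<close>

lemma integrable_if_rapidly_decreasing:
  fixes f :: "'a::euclidean_space \<Rightarrow> real"
  assumes [measurable]: "f \<in> borel_measurable borel"
    and bound: "\<And>x. \<bar>f x\<bar> * (1 + (norm x)\<^sup>2) ^ DIM('a) \<le> C"
  shows "integrable lborel f"
proof -
  have "set_integrable lborel UNIV (\<lambda>x::real. inverse (1 + x\<^sup>2))"
    using integrable_inverse_1_plus_square by (simp add: einterval_iff einterval_def)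
  then have int: "integrable lborel (\<lambda>x::real. inverse (1 + x\<^sup>2))"
    by (simp add: set_integrable_def)
  have "integrable lborel (\<lambda>x::'a. C * (\<Prod>b\<in>Basis. inverse (1 + (x \<bullet> b)\<^sup>2)))"
    by (intro integrable_mult_right integrable_lborel_prod int)
  then show ?thesis
  proof (rule Bochner_Integration.integrable_bound)
    show "AE x in lborel. norm (f x) \<le> norm (C * (\<Prod>b\<in>Basis. inverse (1 + (x \<bullet> b)\<^sup>2)))"
    proof (rule AE_I2)
      fix x :: 'a
      have "(\<Prod>b\<in>Basis. 1 + (x \<bullet> b)\<^sup>2) \<le> (\<Prod>b\<in>(Basis::'a set). 1 + (norm x)\<^sup>2)"
        by (intro prod_mono conjI add_left_mono) (auto simp: abs_le_square_iff[symmetric] Basis_le_norm)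
      then have "\<bar>f x\<bar> * (\<Prod>b\<in>Basis. 1 + (x \<bullet> b)\<^sup>2) \<le> C"
        using bound[of x] by (intro order_trans[OF mult_left_mono bound[of x]]) auto
      moreover have "0 < (\<Prod>b\<in>Basis. 1 + (x \<bullet> b)\<^sup>2)"
        by (intro prod_pos) (auto simp: add_pos_nonneg)
      ultimately have "\<bar>f x\<bar> \<le> C / (\<Prod>b\<in>Basis. 1 + (x \<bullet> b)\<^sup>2)"
        by (simp add: pos_le_divide_eq)
      also have "\<dots> = C * (\<Prod>b\<in>Basis. inverse (1 + (x \<bullet> b)\<^sup>2))"
        by (simp add: divide_inverse prod_inversef[symmetric] o_def)
      finally show "norm (f x) \<le> norm (C * (\<Prod>b\<in>Basis. inverse (1 + (x \<bullet> b)\<^sup>2)))"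
        by simp
    qed
  qed auto
qed

lemma integrable_power_mult_exp_powr:
  fixes a p :: real
  assumes "a > 0" "p > 0"
  shows "integrable lborel (\<lambda>x::'a::euclidean_space. norm x ^ k * exp (- a * norm x powr p))"
proof -
  let ?n = "DIM('a)"
  obtain C where C: "\<And>r. r \<ge> 0 \<Longrightarrow> r ^ k * exp (- a * r powr p) \<le> C"
    using power_mult_exp_powr_bounded[OF assms] by blast
  obtain D where D: "\<And>r. r \<ge> 0 \<Longrightarrow> r ^ (k + 2 * ?n) * exp (- a * r powr p) \<le> D"
    using power_mult_exp_powr_bounded[OF assms] by blast
  show ?thesis
  proof (rule integrable_if_rapidly_decreasing)
    fix x :: 'a
    define r where "r = norm x"
    have "r \<ge> 0" by (simp add: r_def)
    \<comment> \<open>This trades the polynomial for its two extreme powers, so that only the bounds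
      \<open>C\<close> and \<open>D\<close> are needed.\<close>
    have "(1 + r\<^sup>2) ^ ?n \<le> 2 ^ ?n * (1 + r ^ (2 * ?n))"
    proof (cases "r \<le> 1")
      case True
      then have "(1 + r\<^sup>2) ^ ?n \<le> 2 ^ ?n"
        using \<open>r \<ge> 0\<close> by (intro power_mono) (simp_all add: power_le_one)
      also have "\<dots> \<le> 2 ^ ?n * (1 + r ^ (2 * ?n))" using \<open>r \<ge> 0\<close> by simp
      finally show ?thesis .
    next
      case False
      then have "(1 + r\<^sup>2) ^ ?n \<le> (2 * r\<^sup>2) ^ ?n"
        by (intro power_mono) (simp_all add: one_le_power)
      also have "\<dots> \<le> 2 ^ ?n * (1 + r ^ (2 * ?n))" by (simp add: power_mult power_mult_distrib)
      finally show ?thesis .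
    qed
    then have "r ^ k * exp (- a * r powr p) * (1 + r\<^sup>2) ^ ?n
        \<le> r ^ k * exp (- a * r powr p) * (2 ^ ?n * (1 + r ^ (2 * ?n)))"
      using \<open>r \<ge> 0\<close> by (intro mult_left_mono) auto
    also have "\<dots> = 2 ^ ?n * (r ^ k * exp (- a * r powr p) + r ^ (k + 2 * ?n) * exp (- a * r powr p))"
      by (simp only: power_add distrib_left distrib_right mult_1_right mult_ac)
    also have "\<dots> \<le> 2 ^ ?n * (C + D)"
      using C[OF \<open>r \<ge> 0\<close>] D[OF \<open>r \<ge> 0\<close>] by (intro mult_left_mono add_mono) auto
    finally show "\<bar>norm x ^ k * exp (- a * norm x powr p)\<bar> * (1 + (norm x)\<^sup>2) ^ ?n \<le> 2 ^ ?n * (C + D)"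
      by (simp add: r_def abs_mult)
  qed measurable
qed

section \<open>The gradient on the Fourier side\<close>

lemma integrable_pair_mult:
  fixes f :: "'a::euclidean_space \<Rightarrow> real" and g :: "'b::euclidean_space \<Rightarrow> real"
  assumes f: "integrable lborel f" and g: "integrable lborel g"
  shows "integrable (lborel \<Otimes>\<^sub>M lborel) (\<lambda>p. f (fst p) * g (snd p))"
proof (rule lborel_pair.Fubini_integrable)
  have [measurable]: "f \<in> borel_measurable borel" "g \<in> borel_measurable borel"
    using f g by auto
  show "(\<lambda>p. f (fst p) * g (snd p)) \<in> borel_measurable (lborel \<Otimes>\<^sub>M lborel)"
    by measurable
qed (use f g in \<open>auto simp: abs_mult\<close>)

text \<open>The vector field \<open>\<xi> \<mapsto> - Im (\<F> u0) * 2 \<pi> \<xi>\<close>, which represents \<open>\<nabla>u(0,t)\<close> on the Fourier side.\<close>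

definition fourier_grad :: "('a::euclidean_space \<Rightarrow> real) \<Rightarrow> 'a \<Rightarrow> 'a" where
  "fourier_grad u0 \<xi> = (\<integral>y. u0 y * sin (2 * pi * (y \<bullet> \<xi>)) \<partial>lborel) *\<^sub>R (2 * pi) *\<^sub>R \<xi>"

text \<open>The multiplier \<open>m\<close> stays abstract because both the exponent
  \<open>2 * s\<close> and the exponent 2 are needed. The three moment conditions are those of
  \<open>GDERIV_integral_cos\<close>, multiplied by the integrability of \<open>u0\<close>.\<close>

context
  fixes u0 m :: "'a::euclidean_space \<Rightarrow> real"
  assumes u0: "integrable lborel u0"
    and m0: "integrable lborel m" and m1: "integrable lborel (\<lambda>\<xi>. m \<xi> * norm \<xi>)"
    and m2: "integrable lborel (\<lambda>\<xi>. m \<xi> * (norm \<xi>)\<^sup>2)"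
begin

private lemma measurables [measurable]: "u0 \<in> borel_measurable borel" "m \<in> borel_measurable borel"
  using u0 m0 by auto

private lemma integrable_sin:
  "integrable (lborel \<Otimes>\<^sub>M lborel)
     (\<lambda>p. (u0 (fst p) * m (snd p) * sin (2 * pi * (fst p \<bullet> snd p))) *\<^sub>R (2 * pi) *\<^sub>R snd p)"
proof (rule Bochner_Integration.integrable_bound)
  show "integrable (lborel \<Otimes>\<^sub>M lborel) (\<lambda>p. 2 * pi * (u0 (fst p) * (m (snd p) * norm (snd p))))"
    by (intro integrable_mult_right integrable_pair_mult[OF u0 m1])
  show "AE p in lborel \<Otimes>\<^sub>M lborel. norm ((u0 (fst p) * m (snd p) * sin (2 * pi * (fst p \<bullet> snd p))) *\<^sub>R (2 * pi) *\<^sub>R snd p)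
     \<le> norm (2 * pi * (u0 (fst p) * (m (snd p) * norm (snd p))))"
  proof (rule AE_I2)
    fix p :: "'a \<times> 'a"
    have "norm ((u0 (fst p) * m (snd p) * sin (2 * pi * (fst p \<bullet> snd p))) *\<^sub>R (2 * pi) *\<^sub>R snd p)
        = (2 * pi * (\<bar>u0 (fst p)\<bar> * (\<bar>m (snd p)\<bar> * norm (snd p)))) * \<bar>sin (2 * pi * (fst p \<bullet> snd p))\<bar>"
      by (simp add: abs_mult mult_ac)
    also have "\<dots> \<le> 2 * pi * (\<bar>u0 (fst p)\<bar> * (\<bar>m (snd p)\<bar> * norm (snd p)))"
      by (intro mult_right_le_one_le) auto
    finally show "norm ((u0 (fst p) * m (snd p) * sin (2 * pi * (fst p \<bullet> snd p))) *\<^sub>R (2 * pi) *\<^sub>R snd p)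
     \<le> norm (2 * pi * (u0 (fst p) * (m (snd p) * norm (snd p))))"
      by (simp add: abs_mult)
  qed
qed measurable

private lemma scaleR_fourier_grad_eq:
  "m \<xi> *\<^sub>R fourier_grad u0 \<xi> =
     (\<integral>y. (u0 y * m \<xi> * sin (2 * pi * (y \<bullet> \<xi>))) *\<^sub>R (2 * pi) *\<^sub>R \<xi> \<partial>lborel)"
proof -
  have "integrable lborel (\<lambda>y. u0 y * sin (2 * pi * (y \<bullet> \<xi>)))"
    by (rule Bochner_Integration.integrable_bound[OF u0])
       (auto simp: abs_mult intro!: mult_right_le_one_le)
  then have "(\<integral>y. (u0 y * sin (2 * pi * (y \<bullet> \<xi>))) *\<^sub>R (m \<xi> *\<^sub>R (2 * pi) *\<^sub>R \<xi>) \<partial>lborel) =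
      (\<integral>y. u0 y * sin (2 * pi * (y \<bullet> \<xi>)) \<partial>lborel) *\<^sub>R (m \<xi> *\<^sub>R (2 * pi) *\<^sub>R \<xi>)"
    by (intro integral_scaleR_left)
  then show ?thesis
    by (simp add: fourier_grad_def mult_ac)
qed

text \<open>The function is a marginal of the jointly integrable function of
  \<open>integrable_sin\<close>, so Fubini supplies its measurability as well as its
  integrability.\<close>

lemma integrable_scaleR_fourier_grad: "integrable lborel (\<lambda>\<xi>. m \<xi> *\<^sub>R fourier_grad u0 \<xi>)"
  unfolding scaleR_fourier_grad_eq
  using lborel_pair.integrable_snd[of "\<lambda>y \<xi>. (u0 y * m \<xi> * sin (2 * pi * (y \<bullet> \<xi>))) *\<^sub>R (2 * pi) *\<^sub>R \<xi>"]
    integrable_sin by (simp add: case_prod_unfold)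

lemma integral_scaleR_fourier_grad_swap:
  "(\<integral>\<xi>. m \<xi> *\<^sub>R fourier_grad u0 \<xi> \<partial>lborel) =
   (\<integral>y. u0 y *\<^sub>R (\<integral>\<xi>. (m \<xi> * sin (2 * pi * (y \<bullet> \<xi>))) *\<^sub>R (2 * pi) *\<^sub>R \<xi> \<partial>lborel) \<partial>lborel)"
proof -
  have "(\<integral>\<xi>. m \<xi> *\<^sub>R fourier_grad u0 \<xi> \<partial>lborel) =
    (\<integral>y. \<integral>\<xi>. (u0 y * m \<xi> * sin (2 * pi * (y \<bullet> \<xi>))) *\<^sub>R (2 * pi) *\<^sub>R \<xi> \<partial>lborel \<partial>lborel)"
    unfolding scaleR_fourier_grad_eq
    by (rule lborel_pair.Fubini_integral) (use integrable_sin in \<open>simp add: case_prod_unfold\<close>)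
  also have "\<dots> = (\<integral>y. u0 y *\<^sub>R (\<integral>\<xi>. (m \<xi> * sin (2 * pi * (y \<bullet> \<xi>))) *\<^sub>R (2 * pi) *\<^sub>R \<xi> \<partial>lborel) \<partial>lborel)"
  proof (rule Bochner_Integration.integral_cong[OF refl])
    fix y :: 'a
    show "(\<integral>\<xi>. (u0 y * m \<xi> * sin (2 * pi * (y \<bullet> \<xi>))) *\<^sub>R (2 * pi) *\<^sub>R \<xi> \<partial>lborel) =
        u0 y *\<^sub>R (\<integral>\<xi>. (m \<xi> * sin (2 * pi * (y \<bullet> \<xi>))) *\<^sub>R (2 * pi) *\<^sub>R \<xi> \<partial>lborel)"
      by (cases "u0 y = 0")
         (simp_all add: mult_ac flip: integral_scaleR_right)
  qed
  finally show ?thesis .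
qed

text \<open>Both integrations are merged into one over pairs (y, xi), so that a single
  differentiation under the integral suffices. The shift by \<open>y\<close> becomes the phase
  \<open>b\<close>; at x = 0 only this phase remains, and its sign cancels the minus of the
  derivative of the cosine.\<close>

lemma GDERIV_fourier_convolution:
  "GDERIV (\<lambda>x. \<integral>y. (\<integral>\<xi>. m \<xi> * cos (2 * pi * ((x - y) \<bullet> \<xi>)) \<partial>lborel) * u0 y \<partial>lborel) 0
     :> (\<integral>\<xi>. m \<xi> *\<^sub>R fourier_grad u0 \<xi> \<partial>lborel)"
proof -
  let ?P = "lborel \<Otimes>\<^sub>M lborel :: ('a \<times> 'a) measure"
  define c where "c p = u0 (fst p) * m (snd p)" for p
  define b where "b p = - (2 * pi * (fst p \<bullet> snd p))" for p :: "'a \<times> 'a"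
  define v where "v p = (2 * pi) *\<^sub>R snd p" for p :: "'a \<times> 'a"
  have [measurable]: "v \<in> borel_measurable ?P" "b \<in> borel_measurable ?P"
    unfolding v_def b_def by measurable
  have c0: "integrable ?P c"
    unfolding c_def by (intro integrable_pair_mult u0 m0)
  have "integrable ?P (\<lambda>p. 2 * pi * (u0 (fst p) * (m (snd p) * norm (snd p))))"
    by (intro integrable_mult_right integrable_pair_mult[OF u0 m1])
  then have c1: "integrable ?P (\<lambda>p. c p * norm (v p))"
    by (simp add: c_def v_def mult_ac)
  have "integrable ?P (\<lambda>p. (2 * pi)\<^sup>2 * (u0 (fst p) * (m (snd p) * (norm (snd p))\<^sup>2)))"
    by (intro integrable_mult_right integrable_pair_mult[OF u0 m2])
  then have c2: "integrable ?P (\<lambda>p. c p * (norm (v p))\<^sup>2)"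
    by (simp add: c_def v_def mult_ac power_mult_distrib)
  have "GDERIV (\<lambda>x. \<integral>p. c p * cos (x \<bullet> v p + b p) \<partial>?P) 0 :>
      - (\<integral>p. (c p * sin (0 \<bullet> v p + b p)) *\<^sub>R v p \<partial>?P)"
    by (rule GDERIV_integral_cos) (use c0 c1 c2 in auto)
  also have "- (\<integral>p. (c p * sin (0 \<bullet> v p + b p)) *\<^sub>R v p \<partial>?P) =
     (\<integral>p. (u0 (fst p) * m (snd p) * sin (2 * pi * (fst p \<bullet> snd p))) *\<^sub>R (2 * pi) *\<^sub>R snd p \<partial>?P)"
    by (simp add: c_def b_def v_def)
  also have "\<dots> = (\<integral>\<xi>. m \<xi> *\<^sub>R fourier_grad u0 \<xi> \<partial>lborel)"
    unfolding scaleR_fourier_grad_eq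
    using lborel_pair.integral_snd[of "\<lambda>y \<xi>. (u0 y * m \<xi> * sin (2 * pi * (y \<bullet> \<xi>))) *\<^sub>R (2 * pi) *\<^sub>R \<xi>"]
      integrable_sin by (simp add: case_prod_unfold)
  also have "(\<lambda>x. \<integral>p. c p * cos (x \<bullet> v p + b p) \<partial>?P) =
      (\<lambda>x. \<integral>y. (\<integral>\<xi>. m \<xi> * cos (2 * pi * ((x - y) \<bullet> \<xi>)) \<partial>lborel) * u0 y \<partial>lborel)"
  proof
    fix x :: 'a
    have "integrable ?P (\<lambda>p. c p * cos (x \<bullet> v p + b p))"
      by (rule Bochner_Integration.integrable_bound[OF c0])
         (use c0 in \<open>auto simp: abs_mult intro!: mult_right_le_one_le\<close>)
    then have "(\<integral>p. c p * cos (x \<bullet> v p + b p) \<partial>?P) =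
        (\<integral>y. \<integral>\<xi>. c (y, \<xi>) * cos (x \<bullet> v (y, \<xi>) + b (y, \<xi>)) \<partial>lborel \<partial>lborel)"
      by (rule lborel_pair.integral_fst'[symmetric])
    also have "\<dots> = (\<integral>y. (\<integral>\<xi>. m \<xi> * cos (2 * pi * ((x - y) \<bullet> \<xi>)) \<partial>lborel) * u0 y \<partial>lborel)"
    proof (rule Bochner_Integration.integral_cong[OF refl])
      fix y :: 'a
      have "c (y, \<xi>) * cos (x \<bullet> v (y, \<xi>) + b (y, \<xi>)) = (m \<xi> * cos (2 * pi * ((x - y) \<bullet> \<xi>))) * u0 y" for \<xi>
        by (simp add: c_def v_def b_def inner_diff_left algebra_simps)
      then show "(\<integral>\<xi>. c (y, \<xi>) * cos (x \<bullet> v (y, \<xi>) + b (y, \<xi>)) \<partial>lborel) =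
        (\<integral>\<xi>. m \<xi> * cos (2 * pi * ((x - y) \<bullet> \<xi>)) \<partial>lborel) * u0 y"
        by (simp only: integral_mult_left_zero)
    qed
    finally show "(\<integral>p. c p * cos (x \<bullet> v p + b p) \<partial>?P) =
        (\<integral>y. (\<integral>\<xi>. m \<xi> * cos (2 * pi * ((x - y) \<bullet> \<xi>)) \<partial>lborel) * u0 y \<partial>lborel)" .
  qed
  finally show ?thesis .
qed

end

section \<open>Gaussian and fractional multipliers\<close>

lemma exp_powr_moments:
  fixes a p :: real
  assumes "a > 0" "p > 0"
  shows "integrable lborel (\<lambda>\<xi>::'a::euclidean_space. exp (- a * norm \<xi> powr p))"
    and "integrable lborel (\<lambda>\<xi>::'a::euclidean_space. exp (- a * norm \<xi> powr p) * norm \<xi>)"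
    and "integrable lborel (\<lambda>\<xi>::'a::euclidean_space. exp (- a * norm \<xi> powr p) * (norm \<xi>)\<^sup>2)"
  using integrable_power_mult_exp_powr[OF assms, of 0, where ?'a='a]
    integrable_power_mult_exp_powr[OF assms, of 1, where ?'a='a]
    integrable_power_mult_exp_powr[OF assms, of 2, where ?'a='a]
  by (simp_all add: mult.commute)

text \<open>Two gradients of the same function are compared: one by differentiating the cosine
  integral, the other from its closed form \<open>fourier_gaussian\<close> at the frequency 2 pi x,
  where |2 pi x|^2 / (4 a) produces the rate \<open>pi\<^sup>2 / a\<close>.\<close>

lemma fourier_gaussian_grad:
  fixes y :: "'a::euclidean_space"
  assumes "a > 0"
  shows "(\<integral>\<xi>. (exp (- a * norm \<xi> powr 2) * sin (2 * pi * (y \<bullet> \<xi>))) *\<^sub>R (2 * pi) *\<^sub>R \<xi> \<partial>lborel) =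
    (sqrt (pi / a) ^ DIM('a) * (2 * pi\<^sup>2 / a) * exp (- (pi\<^sup>2 / a) * norm y powr 2)) *\<^sub>R y"
    (is "?I = ?C *\<^sub>R y")
proof -
  let ?m = "\<lambda>\<xi>::'a. exp (- a * norm \<xi> powr 2)"
  let ?K = "\<lambda>x. \<integral>\<xi>. ?m \<xi> * cos (x \<bullet> ((2 * pi) *\<^sub>R \<xi>) + 0) \<partial>lborel"
  note mom = exp_powr_moments[OF assms, of 2, where ?'a='a, simplified]
  have "GDERIV ?K y :> - (\<integral>\<xi>. (?m \<xi> * sin (y \<bullet> ((2 * pi) *\<^sub>R \<xi>) + 0)) *\<^sub>R ((2 * pi) *\<^sub>R \<xi>) \<partial>lborel)"
  proof (rule GDERIV_integral_cos)
    show "integrable lborel ?m" using mom(1) by simp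
    have "integrable lborel (\<lambda>\<xi>. (2 * pi) * (?m \<xi> * norm \<xi>))"
      using mom(2) by (intro integrable_mult_right) simp
    then show "integrable lborel (\<lambda>\<xi>. ?m \<xi> * norm ((2 * pi) *\<^sub>R \<xi>))" by (simp add: mult_ac)
    have "integrable lborel (\<lambda>\<xi>. (2 * pi)\<^sup>2 * (?m \<xi> * (norm \<xi>)\<^sup>2))"
      using mom(3) by (intro integrable_mult_right) simp
    then show "integrable lborel (\<lambda>\<xi>. ?m \<xi> * (norm ((2 * pi) *\<^sub>R \<xi>))\<^sup>2)"
      by (simp add: mult_ac power_mult_distrib)
  qed auto
  then have 1: "GDERIV ?K y :> - ?I" by simp
  have "?K x = sqrt (pi / a) ^ DIM('a) * exp (- (pi\<^sup>2 / a) * (x \<bullet> x))" for x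
    using fourier_gaussian[OF assms, of "(2 * pi) *\<^sub>R x"] assms
    by (simp add: power_mult_distrib power2_norm_eq_inner)
  then have "?K = (\<lambda>x. sqrt (pi / a) ^ DIM('a) * exp (- (pi\<^sup>2 / a) * (x \<bullet> x)))" ..
  moreover have "GDERIV (\<lambda>x. sqrt (pi / a) ^ DIM('a) * exp (- (pi\<^sup>2 / a) * (x \<bullet> x))) y :> - (?C *\<^sub>R y)"
  proof -
    have "GDERIV (\<lambda>x. x \<bullet> x) y :> 2 *\<^sub>R y"
      unfolding gderiv_def
      by (rule has_derivative_eq_rhs[OF has_derivative_inner[OF has_derivative_ident has_derivative_ident]])
         (auto simp: fun_eq_iff inner_commute)
    moreover have "((\<lambda>s. sqrt (pi / a) ^ DIM('a) * exp (- (pi\<^sup>2 / a) * s)) has_real_derivative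
        sqrt (pi / a) ^ DIM('a) * (exp (- (pi\<^sup>2 / a) * (y \<bullet> y)) * - (pi\<^sup>2 / a))) (at (y \<bullet> y))"
      using assms by (auto intro!: derivative_eq_intros)
    ultimately have "GDERIV (\<lambda>x. sqrt (pi / a) ^ DIM('a) * exp (- (pi\<^sup>2 / a) * (x \<bullet> x))) y :>
        (sqrt (pi / a) ^ DIM('a) * (exp (- (pi\<^sup>2 / a) * (y \<bullet> y)) * - (pi\<^sup>2 / a))) *\<^sub>R 2 *\<^sub>R y"
      by (rule GDERIV_DERIV_compose)
    then show ?thesis
      by (simp add: power2_norm_eq_inner mult_ac)
  qed
  ultimately have "GDERIV ?K y :> - (?C *\<^sub>R y)" by (simp only:)
  with 1 have "- ?I = - (?C *\<^sub>R y)" by (rule GDERIV_unique)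
  then show ?thesis by simp
qed

lemma frac_heat_kernel_eq_integral_cos:
  fixes x :: "'a::euclidean_space"
  assumes "0 < s" "0 < t"
  shows "frac_heat_kernel s t x =
    (\<integral>\<xi>. exp (- (t * (2 * pi) powr (2 * s)) * norm \<xi> powr (2 * s)) * cos (2 * pi * (x \<bullet> \<xi>)) \<partial>lborel)"
proof -
  let ?m = "\<lambda>\<xi>::'a. exp (- (t * (2 * pi) powr (2 * s)) * norm \<xi> powr (2 * s))"
  have m: "exp (- t * (2 * pi * norm \<xi>) powr (2 * s)) = ?m \<xi>" for \<xi> :: 'a
    by (simp add: powr_mult)
  have int: "integrable lborel (\<lambda>\<xi>. complex_of_real (?m \<xi>) * exp (2 * of_real pi * \<i> * of_real (x \<bullet> \<xi>)))"
  proof (rule Bochner_Integration.integrable_bound)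
    show "integrable lborel ?m" using assms by (intro exp_powr_moments) auto
  qed (auto simp: norm_mult)
  show ?thesis
    unfolding frac_heat_kernel_def inverse_fourier_def m
    by (subst integral_Re[OF int, symmetric]) (simp add: Re_exp mult_ac)
qed

section \<open>The chain of equivalences\<close>

theorem theorem3p1:
  fixes s L :: real
    and u0 :: "real ^ 'n \<Rightarrow> real"
    and u :: "real ^ 'n \<Rightarrow> real \<Rightarrow> real"
  assumes "0 < s" and "s < 1"
    and "u0 \<in> C0_infinity"
    and "L > 0" and "supp u0 \<subseteq> ball 0 L"
    and "u = frac_heat_solution s u0"
  shows "(\<forall>t>0. GDERIV (\<lambda>x. u x t) 0 :> 0) \<longleftrightarrow>
         (\<forall>r\<ge>0. (\<integral>\<omega>. u0 (r *\<^sub>R \<omega>) *\<^sub>R \<omega> \<partial>sphere_measure) = 0)"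
proof -
  let ?F = "fourier_grad u0"
  have "C_k 0 u0"
    using assms(3) unfolding C0_infinity_def by blast
  then have cont: "continuous_on UNIV u0" by simp
  have outside: "u0 x = 0" if "L \<le> norm x" for x
  proof (rule ccontr)
    assume "u0 x \<noteq> 0"
    then have "x \<in> supp u0"
      unfolding supp_def by (intro subsetD[OF closure_subset]) simp
    with assms(5) that show False by auto
  qed
  have int_cont: "integrable lborel g"
    if "continuous_on UNIV g" "\<And>x. u0 x = 0 \<Longrightarrow> g x = 0"
    for g :: "real ^ 'n \<Rightarrow> 'b::{banach, second_countable_topology}"
  proof -
    have "integrable lborel (\<lambda>x. indicator (cball 0 L) x *\<^sub>R g x)"
      by (intro borel_integrable_compact compact_cball continuous_on_subset[OF that(1)] subset_UNIV)
    also have "(\<lambda>x. indicator (cball 0 L) x *\<^sub>R g x) = g"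
    proof
      fix x show "indicator (cball 0 L) x *\<^sub>R g x = g x"
        using that(2)[of x] outside[of x] by (cases "norm x \<le> L") auto
    qed
    finally show ?thesis .
  qed
  have u0: "integrable lborel u0"
    by (rule int_cont[OF cont])
  have u1: "integrable lborel (\<lambda>y. u0 y *\<^sub>R y)"
    by (rule int_cont) (auto intro!: continuous_intros cont)
  note mom = exp_powr_moments[where ?'a="real^'n"]
  have intF: "integrable lborel (\<lambda>\<xi>. exp (- a * norm \<xi> powr p) *\<^sub>R ?F \<xi>)" if "a > 0" "p > 0" for a p
    by (rule integrable_scaleR_fourier_grad[OF u0 mom[OF that]])

  \<comment> \<open>The constant split off from the symbol (2 pi |xi|)^(2s); since \<open>t\<close>
    ranges over all positive numbers, it is absorbed into the time below.\<close>
  define \<tau> where "\<tau> = (2 * pi) powr (2 * s)"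
  have \<tau>: "\<tau> > 0" by (simp add: \<tau>_def)
  have grad: "GDERIV (\<lambda>x. u x t) 0 :> (\<integral>\<xi>. exp (- (t * \<tau>) * norm \<xi> powr (2 * s)) *\<^sub>R ?F \<xi> \<partial>lborel)"
    if "t > 0" for t
  proof -
    have "t * \<tau> > 0" "2 * s > 0" using \<open>t > 0\<close> \<tau> assms(1) by auto
    from GDERIV_fourier_convolution[OF u0 mom[OF this]] show ?thesis
      using \<open>t > 0\<close> by (simp add: assms(6) frac_heat_solution_def
          frac_heat_kernel_eq_integral_cos[OF assms(1) \<open>t > 0\<close>] \<tau>_def)
  qed
  \<comment> \<open>By \<open>grad\<close> the gradient exists and is known, so by uniqueness
    condition (1) is a statement about its value.\<close>
  have "(\<forall>t>0. GDERIV (\<lambda>x. u x t) 0 :> 0) \<longleftrightarrow>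
      (\<forall>t>0. (\<integral>\<xi>. exp (- (t * \<tau>) * norm \<xi> powr (2 * s)) *\<^sub>R ?F \<xi> \<partial>lborel) = 0)"
    by (intro all_cong1 imp_cong refl iffI) (use grad GDERIV_unique in fastforce)+
  also have "\<dots> \<longleftrightarrow> (\<forall>a>0. (\<integral>\<xi>. exp (- a * norm \<xi> powr (2 * s)) *\<^sub>R ?F \<xi> \<partial>lborel) = 0)"
  proof (intro iffI allI impI)
    fix a :: real
    assume "\<forall>t>0. (\<integral>\<xi>. exp (- (t * \<tau>) * norm \<xi> powr (2 * s)) *\<^sub>R ?F \<xi> \<partial>lborel) = 0" "a > 0"
    then have "(\<integral>\<xi>. exp (- (a / \<tau> * \<tau>) * norm \<xi> powr (2 * s)) *\<^sub>R ?F \<xi> \<partial>lborel) = 0"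
      using \<tau> by (blast intro: divide_pos_pos)
    then show "(\<integral>\<xi>. exp (- a * norm \<xi> powr (2 * s)) *\<^sub>R ?F \<xi> \<partial>lborel) = 0"
      using \<tau> by simp
  qed (use \<tau> in \<open>blast intro: mult_pos_pos\<close>)
  \<comment> \<open>The transfer holds between any two positive exponents, so both directions come
    from the same fact with \<open>2 * s\<close> and 2 exchanged.\<close>
  also have "\<dots> \<longleftrightarrow> (\<forall>a>0. (\<integral>\<xi>. exp (- a * norm \<xi> powr 2) *\<^sub>R ?F \<xi> \<partial>lborel) = 0)"
  proof -
    have "(\<integral>\<xi>. exp (- b * norm \<xi> powr q) *\<^sub>R ?F \<xi> \<partial>lborel) = 0"
      if "\<forall>a>0. (\<integral>\<xi>. exp (- a * norm \<xi> powr p) *\<^sub>R ?F \<xi> \<partial>lborel) = 0" "p > 0" "q > 0" "b > 0" for p q b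
      by (rule integral_exp_powr_transfer[where q=norm and p=p]) (use that intF in auto)
    note transfer = this
    show ?thesis
      using transfer[of "2 * s" 2] transfer[of 2 "2 * s"] assms(1) by auto
  qed
  \<comment> \<open>After Fubini the inner integral is a Gaussian times \<open>y\<close>, up to a
    positive scalar that depends on \<open>a\<close> alone and therefore does not affect
    vanishing.\<close>
  also have "\<dots> \<longleftrightarrow> (\<forall>a>0. (\<integral>y. exp (- (pi\<^sup>2 / a) * norm y powr 2) *\<^sub>R (u0 y *\<^sub>R y) \<partial>lborel) = 0)"
  proof -
    have "(\<integral>\<xi>. exp (- a * norm \<xi> powr 2) *\<^sub>R ?F \<xi> \<partial>lborel) = (sqrt (pi / a) ^ DIM(real^'n) * (2 * pi\<^sup>2 / a)) *\<^sub>R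
        (\<integral>y. exp (- (pi\<^sup>2 / a) * norm y powr 2) *\<^sub>R (u0 y *\<^sub>R y) \<partial>lborel)" if "a > 0" for a
    proof -
      have "(\<integral>\<xi>. exp (- a * norm \<xi> powr 2) *\<^sub>R ?F \<xi> \<partial>lborel) =
        (\<integral>y. (sqrt (pi / a) ^ DIM(real^'n) * (2 * pi\<^sup>2 / a)) *\<^sub>R
          (exp (- (pi\<^sup>2 / a) * norm y powr 2) *\<^sub>R (u0 y *\<^sub>R y)) \<partial>lborel)"
        unfolding integral_scaleR_fourier_grad_swap[OF u0 mom[OF that zero_less_numeral]]
          fourier_gaussian_grad[OF that] by (simp add: mult_ac)
      then show ?thesis
        by (simp only: integral_scaleR_right)
    qed
    then show ?thesis by simp
  qed
  \<comment> \<open>The map taking \<open>a\<close> to \<open>pi\<^sup>2 / a\<close> is an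
    involution of the positive half-line.\<close>
  also have "\<dots> \<longleftrightarrow> (\<forall>a>0. (\<integral>y. exp (- a * norm y powr 2) *\<^sub>R (u0 y *\<^sub>R y) \<partial>lborel) = 0)"
  proof (intro iffI allI impI)
    fix a :: real
    assume "\<forall>a>0. (\<integral>y. exp (- (pi\<^sup>2 / a) * norm y powr 2) *\<^sub>R (u0 y *\<^sub>R y) \<partial>lborel) = 0" "a > 0"
    then have "(\<integral>y. exp (- (pi\<^sup>2 / (pi\<^sup>2 / a)) * norm y powr 2) *\<^sub>R (u0 y *\<^sub>R y) \<partial>lborel) = 0"
      by (elim allE[of _ "pi\<^sup>2 / a"]) simp
    then show "(\<integral>y. exp (- a * norm y powr 2) *\<^sub>R (u0 y *\<^sub>R y) \<partial>lborel) = 0"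
      by simp
  next
    fix a :: real
    assume "\<forall>a>0. (\<integral>y. exp (- a * norm y powr 2) *\<^sub>R (u0 y *\<^sub>R y) \<partial>lborel) = 0" "a > 0"
    moreover have "pi\<^sup>2 / a > 0"
      using \<open>a > 0\<close> by simp
    ultimately show "(\<integral>y. exp (- (pi\<^sup>2 / a) * norm y powr 2) *\<^sub>R (u0 y *\<^sub>R y) \<partial>lborel) = 0"
      by blast
  qed
  also have "\<dots> \<longleftrightarrow> (\<forall>r\<ge>0. (\<integral>\<omega>. u0 (r *\<^sub>R \<omega>) *\<^sub>R \<omega> \<partial>sphere_measure) = 0)"
    by (rule sphere_mean_eq_0_iff[OF cont outside u1, symmetric])
  finally show ?thesis .
qed

end
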